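(* Let $\mathbb{B}^n=\{z\in\mathbb{C}^n:|z|<1\}$ be the unit ball, let $r\in(0,1)$, and let $\Omega=\{z\in\mathbb{C}^n: r<|z|<1\}$. Let $p\in\Omega$ and let $\xi\in T_p\Omega=\mathbb{C}^n$, $\xi\neq 0$, satisfy $\xi\cdot\overline{p}=\sum_{j=1}^n\xi_j\overline{p_j}=0$. Then $$F_B^{\Omega}(p,\xi)<F_B^{\mathbb{B}^n}(p,\xi).$$
   Context: $|z|$ denotes the Euclidean norm on $\mathbb{C}^n$. For a bounded domain $D\subset\mathbb{C}^n$, $K_D$ denotes the Bergman kernel of $D$ (the reproducing kernel of the space $L^2_h(D)$ of square-integrable holomorphic functions on $D$). The Bergman metric of $D$ at $p\in D$ in direction $\xi\in\mathbb{C}^n$ is $$F_B^{D}(p,\xi)=\left(\sum_{\nu,\mu=1}^{n}\frac{\partial^2\log K_D(z,z)}{\partial z_\nu\,\partial\overline{z_\mu}}\Big|_{z=p}\,\xi_\nu\overline{\xi_\mu}\right)^{1/2}.$$ *)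

theory Defs
  imports "HOL-Analysis.Analysis"
begin

text \<open>
  Holomorphy in several complex variables, as complex Frechet differentiability: the real
  derivative exists at every point and is complex linear.
\<close>

definition holomorphic_vec_on :: "(complex ^ 'n \<Rightarrow> complex) \<Rightarrow> (complex ^ 'n) set \<Rightarrow> bool" where
  "holomorphic_vec_on f D \<longleftrightarrow>
     (\<forall>z\<in>D. \<exists>f'. (f has_derivative f') (at z) \<and> (\<forall>c v. f' (c *s v) = c * f' v))"

definition L2h :: "(complex ^ 'n) set \<Rightarrow> (complex ^ 'n \<Rightarrow> complex) set" where
  "L2h D = {f. holomorphic_vec_on f D \<and> set_integrable lborel D (\<lambda>z. (cmod (f z))\<^sup>2)}"

text \<open>
  The values of \<open>K\<close> outside \<open>D \<times> D\<close> are normalised to 0; among total functions the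
  reproducing property determines \<open>K\<close> only on \<open>D \<times> D\<close>.
\<close>

definition is_bergman_kernel ::
    "(complex ^ 'n) set \<Rightarrow> (complex ^ 'n \<Rightarrow> complex ^ 'n \<Rightarrow> complex) \<Rightarrow> bool" where
  "is_bergman_kernel D K \<longleftrightarrow>
     (\<forall>w\<in>D. (\<lambda>z. K z w) \<in> L2h D) \<and>
     (\<forall>f\<in>L2h D. \<forall>w\<in>D. f w = (LINT z:D|lborel. f z * cnj (K z w))) \<and>
     (\<forall>z w. z \<notin> D \<or> w \<notin> D \<longrightarrow> K z w = 0)"

definition bergman_kernel :: "(complex ^ 'n) set \<Rightarrow> complex ^ 'n \<Rightarrow> complex ^ 'n \<Rightarrow> complex" where
  "bergman_kernel D = (THE K. is_bergman_kernel D K)"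

definition real_dir_deriv ::
    "complex ^ 'n \<Rightarrow> (complex ^ 'n \<Rightarrow> complex) \<Rightarrow> complex ^ 'n \<Rightarrow> complex" where
  "real_dir_deriv v u p = vector_derivative (\<lambda>t::real. u (p + t *\<^sub>R v)) (at 0)"

text \<open>
  The Wirtinger operators \<open>(\<partial>/\<partial>x - \<i> \<partial>/\<partial>y) / 2\<close> and \<open>(\<partial>/\<partial>x + \<i> \<partial>/\<partial>y) / 2\<close> in the
  coordinate \<open>z\<^sub>k = x + \<i> y\<close>.
\<close>

definition wirtinger_z :: "'n \<Rightarrow> (complex ^ 'n \<Rightarrow> complex) \<Rightarrow> complex ^ 'n \<Rightarrow> complex" where
  "wirtinger_z k u p =
     (real_dir_deriv (axis k 1) u p - \<i> * real_dir_deriv (axis k \<i>) u p) / 2"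

definition wirtinger_zbar :: "'n \<Rightarrow> (complex ^ 'n \<Rightarrow> complex) \<Rightarrow> complex ^ 'n \<Rightarrow> complex" where
  "wirtinger_zbar k u p =
     (real_dir_deriv (axis k 1) u p + \<i> * real_dir_deriv (axis k \<i>) u p) / 2"

text \<open>
  On a bounded domain \<open>K(z, z)\<close> is real and positive, and the Hermitian form below is real and
  nonnegative, so the two occurrences of \<open>Re\<close> only change the type.
\<close>

definition bergman_metric :: "(complex ^ 'n) set \<Rightarrow> complex ^ 'n \<Rightarrow> complex ^ 'n \<Rightarrow> real" where
  "bergman_metric D p \<xi> =
     sqrt (Re (\<Sum>\<nu>\<in>UNIV. \<Sum>\<mu>\<in>UNIV.
       wirtinger_z \<nu>
         (wirtinger_zbar \<mu> (\<lambda>z. complex_of_real (ln (Re (bergman_kernel D z z))))) p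
       * (\<xi> $ \<nu>) * cnj (\<xi> $ \<mu>)))"

end

theory Submission
  imports Defs "HOL-Complex_Analysis.Complex_Analysis"
begin

text \<open>
  Both domains are spherical shells \<open>{z. r < |z| < 1}\<close>; the ball is the case \<open>r = -1\<close>. In dimension at
  least two (forced by \<open>\<xi> \<noteq> 0\<close> being orthogonal to \<open>p \<noteq> 0\<close>) Hartogs' phenomenon shows that
  only nonnegative powers occur, so \<open>K(z, w) = (\<Sum>k. \<langle>z, w\<rangle>^k / m\<^sub>k)\<close> with
  \<open>m\<^sub>k = \<integral>|\<langle>z, e\<rangle>|^(2k)\<close> for any unit vector \<open>e\<close>. Writing \<open>K(z, z) = \<kappa>(|z|\<^sup>2)\<close>, the squared metric
  in a direction orthogonal to \<open>p\<close> is \<open>(\<kappa>'/\<kappa>)(|p|\<^sup>2) |\<xi>|\<^sup>2\<close>, which is a positive multiple of the mean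
  of \<open>k\<close> for the weights \<open>|p|^(2k) / m\<^sub>k\<close>. Scaling the hole gives
  \<open>m\<^sub>k(shell) = (1 - r^(2k+2n)) m\<^sub>k(ball)\<close>, so passing from the ball to the shell multiplies the weights
  by a strictly decreasing sequence, and by Chebyshev's inequality the mean drops strictly.
\<close>

text \<open>Neither polar coordinates nor an orthonormal basis are used to pass from Hartogs'
  phenomenon to the kernel formula. To test the reproducing property at w, let e' = w/|w| (any unit
  vector if w = 0) and integrate f against the conjugate of a power of \<open>herm z e'\<close>.
  Lebesgue measure is invariant under rotations fixing e', so f may be replaced by its average over
  them, which is F(\<open>herm z e'\<close>) with F holomorphic on the whole unit disc and equal to
  f on the line of w near w. Rotating \<open>herm z e'\<close> as well singles out one Taylor
  coefficient of F, multiplied by a moment. Dividing by the moments and summing returns F(|w|) =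
  f(w). The moments are never evaluated. They are positive, independent of the unit vector, and at
  least a multiple of q^(2k) for each q < 1, which makes the series converge on the unit disc; a
  scaling relation compares ball and shell.\<close>

section \<open>Orthogonal invariance of Lebesgue measure\<close>

text \<open>By Vitali's theorem disjoint balls exhaust an open set up to a null set, and
  \<open>T\<close> maps each ball to a ball of the same radius. One inequality is enough: applied to
  the inverse of \<open>T\<close> it yields the other.\<close>

lemma emeasure_orthogonal_image_ge:
  fixes T :: "'a::euclidean_space \<Rightarrow> 'a"
  assumes T: "orthogonal_transformation T" and S: "open S"
  shows "emeasure lborel S \<le> emeasure lborel (T ` S)"
proof -
  define K where "K = {(x::'a, d::real). 0 < d \<and> ball x d \<subseteq> S}"
  have V: "\<exists>i. i \<in> K \<and> x \<in> ball (fst i) (snd i) \<and> snd i < d" if "x \<in> S" "0 < d" for x d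
  proof -
    obtain e where "e > 0" "ball x e \<subseteq> S"
      using S \<open>x \<in> S\<close> open_contains_ball by blast
    then have "(x, min e (d/2)) \<in> K"
      using \<open>0 < d\<close> by (auto simp: K_def)
    moreover have "x \<in> ball x (min e (d/2))" "min e (d/2) < d"
      using \<open>0 < d\<close> \<open>e > 0\<close> by auto
    ultimately show ?thesis by (metis fst_conv snd_conv)
  qed
  obtain C where C: "countable C" "C \<subseteq> K"
      "pairwise (\<lambda>i j. disjnt (ball (fst i) (snd i)) (ball (fst j) (snd j))) C"
      "negligible (S - (\<Union>i \<in> C. ball (fst i) (snd i)))"
    by (rule Vitali_covering_theorem_balls[of S K fst snd, OF V])
  let ?B = "\<lambda>i. ball (fst i) (snd i)"
  have disj: "disjoint_family_on ?B C"
    using C(3) by (auto simp: disjoint_family_on_def pairwise_def disjnt_def)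
  have im: "T ` ?B i = ball (T (fst i)) (snd i)" for i
    using image_orthogonal_transformation_ball[OF T] .
  have inj: "inj T" using orthogonal_transformation_inj[OF T] .
  have disj': "disjoint_family_on (\<lambda>i. T ` ?B i) C"
    using disj inj by (auto simp: disjoint_family_on_def image_Int[symmetric])
  have "open (\<Union>i\<in>C. ?B i)" by blast
  then have Sb: "S - (\<Union>i\<in>C. ?B i) \<in> sets lborel" "(\<Union>i\<in>C. ?B i) \<in> sets lborel"
    using S by (simp_all add: borel_open sets.Diff)
  then have null: "S - (\<Union>i\<in>C. ?B i) \<in> null_sets lborel"
    using C(4) by (auto simp: negligible_iff_null_sets null_sets_completion_iff)
  have "emeasure lborel S \<le> emeasure lborel ((\<Union>i\<in>C. ?B i) \<union> (S - (\<Union>i\<in>C. ?B i)))"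
    by (intro emeasure_mono sets.Un Sb) auto
  also have "\<dots> = emeasure lborel (\<Union>i\<in>C. ?B i)"
    using Sb null by (intro emeasure_Un_null_set) auto
  also have "\<dots> = (\<integral>\<^sup>+ i. emeasure lborel (?B i) \<partial>count_space C)"
    by (intro emeasure_UN_countable disj C(1)) auto
  also have "\<dots> = (\<integral>\<^sup>+ i. emeasure lborel (T ` ?B i) \<partial>count_space C)"
  proof (rule nn_integral_cong)
    fix i assume "i \<in> space (count_space C)"
    then have "snd i > 0" using C(2) by (auto simp: K_def)
    then show "emeasure lborel (?B i) = emeasure lborel (T ` ?B i)"
      by (simp add: im emeasure_ball)
  qed
  also have "\<dots> = emeasure lborel (\<Union>i\<in>C. T ` ?B i)"
    by (intro emeasure_UN_countable[symmetric] disj' C(1)) (simp add: im)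
  also have "\<dots> \<le> emeasure lborel (T ` S)"
  proof (rule emeasure_mono)
    show "(\<Union>i\<in>C. T ` ?B i) \<subseteq> T ` S"
      using C(2) by (force simp: K_def)
    have "open (T ` S)"
      using S orthogonal_transformation_linear[OF T] orthogonal_transformation_surj[OF T]
      by (intro open_surjective_linear_image)
    then show "T ` S \<in> sets lborel" by simp
  qed
  finally show ?thesis .
qed

lemma borel_measurable_orthogonal_transformation:
  fixes T :: "'a::euclidean_space \<Rightarrow> 'a"
  assumes "orthogonal_transformation T"
  shows "T \<in> borel_measurable borel"
  using assms orthogonal_transformation_linear linear_continuous_on borel_measurable_continuous_onI
    linear_conv_bounded_linear by blast

lemma distr_lborel_orthogonal_transformation:
  fixes T :: "'a::euclidean_space \<Rightarrow> 'a"
  assumes T: "orthogonal_transformation T"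
  shows "distr lborel borel T = lborel"
proof (rule lborel_eqI[symmetric])
  fix l u :: 'a
  assume lu: "\<And>b. b \<in> Basis \<Longrightarrow> l \<bullet> b \<le> u \<bullet> b"
  let ?T' = "inv T"
  have T': "orthogonal_transformation ?T'" using orthogonal_transformation_inv[OF T] .
  have bij: "bij T" using orthogonal_transformation_bij[OF T] .
  have op: "open (?T' ` box l u)"
    using orthogonal_transformation_linear[OF T'] orthogonal_transformation_surj[OF T']
    by (intro open_surjective_linear_image) auto
  have "emeasure (distr lborel borel T) (box l u) = emeasure lborel (T -` box l u)"
    using borel_measurable_orthogonal_transformation[OF T] by (subst emeasure_distr) auto
  also have "T -` box l u = ?T' ` box l u"
    using bij by (simp add: bij_vimage_eq_inv_image)
  also have "emeasure lborel \<dots> = emeasure lborel (box l u)"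
  proof (rule antisym)
    have "T ` ?T' ` box l u = box l u"
      using bij by (simp add: image_f_inv_f bij_is_surj)
    then show "emeasure lborel (?T' ` box l u) \<le> emeasure lborel (box l u)"
      using emeasure_orthogonal_image_ge[OF T op] by simp
    show "emeasure lborel (box l u) \<le> emeasure lborel (?T' ` box l u)"
      by (rule emeasure_orthogonal_image_ge[OF T']) auto
  qed
  finally show "emeasure (distr lborel borel T) (box l u) = (\<Prod>b\<in>Basis. (u - l) \<bullet> b)"
    using lu by (simp add: emeasure_lborel_box)
qed simp

lemma integral_orthogonal_transformation:
  fixes T :: "'a::euclidean_space \<Rightarrow> 'a" and h :: "'a \<Rightarrow> 'b::{banach, second_countable_topology}"
  assumes T: "orthogonal_transformation T" and h: "h \<in> borel_measurable borel"
  shows "(LINT z|lborel. h (T z)) = (LINT z|lborel. h z)"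
proof -
  have "(LINT z|lborel. h z) = (LINT z|distr lborel borel T. h z)"
    using distr_lborel_orthogonal_transformation[OF T] by simp
  also have "\<dots> = (LINT z|lborel. h (T z))"
    using h borel_measurable_orthogonal_transformation[OF T] by (subst integral_distr) auto
  finally show ?thesis by simp
qed

lemma integrable_orthogonal_transformation:
  fixes T :: "'a::euclidean_space \<Rightarrow> 'a" and h :: "'a \<Rightarrow> 'b::{banach, second_countable_topology}"
  assumes T: "orthogonal_transformation T" and h: "integrable lborel h"
  shows "integrable lborel (\<lambda>z. h (T z))"
proof -
  have "integrable (distr lborel borel T) h"
    using distr_lborel_orthogonal_transformation[OF T] h by simp
  then show ?thesis
    using h borel_measurable_orthogonal_transformation[OF T] by (subst (asm) integrable_distr_eq) auto
qed

text \<open>Fubini in the parameter and the point: for each fixed \<beta> the integral over z is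
  invariant. The parameter interval has length one, so the average carries no normalising
  factor.\<close>

lemma
  fixes R :: "real \<Rightarrow> 'a::euclidean_space \<Rightarrow> 'a" and h :: "'a \<Rightarrow> 'b::{banach, second_countable_topology}"
  assumes R: "\<And>\<beta>. orthogonal_transformation (R \<beta>)"
    and cont: "continuous_on UNIV (\<lambda>(\<beta>, z). R \<beta> z)"
    and h: "integrable lborel h"
  shows integral_orthogonal_average:
      "(LINT z|lborel. (LINT \<beta>:{0..1}|lborel. h (R \<beta> z))) = (LINT z|lborel. h z)"
    and integrable_orthogonal_average:
      "integrable lborel (\<lambda>z. (LINT \<beta>:{0..1}|lborel. h (R \<beta> z)))"
proof -
  let ?H = "\<lambda>(\<beta>, z). indicator {0..1::real} \<beta> *\<^sub>R h (R \<beta> z)"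
  have [measurable]: "(\<lambda>x. R (fst x) (snd x)) \<in> borel_measurable (lborel \<Otimes>\<^sub>M lborel)"
    using borel_measurable_continuous_onI[OF cont]
    by (simp add: borel_prod[symmetric] case_prod_beta' cong: measurable_cong_sets)
  have hm[measurable]: "h \<in> borel_measurable borel" using h by auto
  have meas: "?H \<in> borel_measurable (lborel \<Otimes>\<^sub>M lborel)"
    unfolding case_prod_beta' by measurable
  have inth: "integrable lborel (\<lambda>z. h (R \<beta> z))" for \<beta>
    using integrable_orthogonal_transformation[OF R h] .
  have int: "integrable (lborel \<Otimes>\<^sub>M lborel) ?H"
  proof (rule lborel_pair.Fubini_integrable[OF meas])
    have eq: "(LINT y|lborel. norm (case (x, y) of (\<beta>, z) \<Rightarrow> indicator {0..1::real} \<beta> *\<^sub>R h (R \<beta> z)))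
        = indicator {0..1} x *\<^sub>R (LINT y|lborel. norm (h y))" for x
      using integral_orthogonal_transformation[OF R, of "\<lambda>z. norm (h z)" x] by simp
    then show "integrable lborel (\<lambda>x. LINT y|lborel. norm (case (x, y) of (\<beta>, z) \<Rightarrow> indicator {0..1::real} \<beta> *\<^sub>R h (R \<beta> z)))"
      unfolding eq by (intro integrable_scaleR_left) auto
    show "AE x in lborel. integrable lborel (\<lambda>y. case (x, y) of (\<beta>, z) \<Rightarrow> indicator {0..1::real} \<beta> *\<^sub>R h (R \<beta> z))"
      using inth by auto
  qed
  have "(LINT z|lborel. LINT \<beta>|lborel. indicator {0..1::real} \<beta> *\<^sub>R h (R \<beta> z))
      = (LINT \<beta>|lborel. LINT z|lborel. indicator {0..1::real} \<beta> *\<^sub>R h (R \<beta> z))"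
    by (rule lborel_pair.Fubini_integral[OF int])
  also have "\<dots> = (LINT \<beta>|lborel. indicator {0..1::real} \<beta> *\<^sub>R (LINT z|lborel. h z))"
    using integral_orthogonal_transformation[OF R hm] by simp
  also have "\<dots> = (LINT z|lborel. h z)"
    by simp
  finally show "(LINT z|lborel. (LINT \<beta>:{0..1}|lborel. h (R \<beta> z))) = (LINT z|lborel. h z)"
    by (simp add: set_lebesgue_integral_def)
  show "integrable lborel (\<lambda>z. (LINT \<beta>:{0..1}|lborel. h (R \<beta> z)))"
    using lborel_pair.integrable_snd[OF int] by (simp add: set_lebesgue_integral_def)
qed

section \<open>The Hermitian product and axial rotations\<close>

definition herm :: "complex ^ 'n \<Rightarrow> complex ^ 'n \<Rightarrow> complex" where
  "herm z w = (\<Sum>j\<in>UNIV. z $ j * cnj (w $ j))"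

lemma herm_add_left: "herm (x + y) w = herm x w + herm y w"
  by (simp add: herm_def distrib_right sum.distrib)

lemma herm_diff_left: "herm (x - y) w = herm x w - herm y w"
  by (simp add: herm_def left_diff_distrib sum_subtractf)

lemma herm_smult_left: "herm (c *s x) w = c * herm x w"
  by (simp add: herm_def sum_distrib_left mult.assoc)

lemma herm_smult_right: "herm x (c *s w) = cnj c * herm x w"
  by (simp add: herm_def sum_distrib_left mult_ac)

lemma herm_scaleR_left: "herm (r *\<^sub>R x) w = of_real r * herm x w"
  by (simp add: herm_def sum_distrib_left mult.assoc scaleR_conv_of_real[where 'a = complex])

lemma herm_commute: "herm w z = cnj (herm z w)"
  by (simp add: herm_def mult.commute)

lemma herm_diff_right: "herm w (x - y) = herm w x - herm w y"
  by (metis herm_commute herm_diff_left complex_cnj_diff)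

lemma Re_herm: "Re (herm z w) = z \<bullet> w"
  by (simp add: herm_def inner_vec_def inner_complex_def)

lemma herm_self: "herm z z = of_real ((norm z)\<^sup>2)"
proof (rule complex_eqI)
  show "Re (herm z z) = Re (of_real ((norm z)\<^sup>2))"
    by (simp add: Re_herm power2_norm_eq_inner)
  show "Im (herm z z) = Im (of_real ((norm z)\<^sup>2))"
    by (simp add: herm_def)
qed

lemma norm_smult_vec: "norm (c *s x) = cmod c * norm (x :: complex ^ 'n)"
proof -
  have "of_real ((norm (c *s x))\<^sup>2) = (of_real ((cmod c * norm x)\<^sup>2) :: complex)"
    unfolding herm_self[symmetric] herm_smult_left herm_smult_right
    using complex_norm_square[of c] by (simp add: herm_self power_mult_distrib mult.commute)
  then have "(norm (c *s x))\<^sup>2 = (cmod c * norm x)\<^sup>2"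
    by (simp only: of_real_eq_iff)
  then show ?thesis
    by (simp add: power2_eq_iff_nonneg)
qed

lemma herm_orthogonal_commute: "herm x y = 0 \<longleftrightarrow> herm y x = 0"
  by (metis herm_commute complex_cnj_zero)

lemma norm_add_herm_orthogonal:
  assumes "herm x y = 0"
  shows "(norm (x + y))\<^sup>2 = (norm x)\<^sup>2 + (norm y)\<^sup>2"
proof -
  have "x \<bullet> y = 0" using assms by (simp flip: Re_herm)
  then show ?thesis by (simp add: norm_add_Pythagorean orthogonal_def)
qed

text \<open>Rotating \<open>z\<close> by a phase makes the product real and nonnegative, which
  reduces the claim to the real Cauchy-Schwarz inequality.\<close>

lemma norm_herm_le: "cmod (herm z w) \<le> norm z * norm w"
proof (cases "herm z w = 0")
  case False
  define c where "c = cnj (sgn (herm z w))"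
  have "cmod c = 1" using False by (simp add: c_def norm_sgn)
  have "c * herm z w = of_real (cmod (herm z w))"
    using False by (simp add: c_def sgn_div_norm scaleR_conv_of_real complex_norm_square[symmetric] power2_eq_square field_simps)
  then have "cmod (herm z w) = Re (herm (c *s z) w)"
    by (simp add: herm_smult_left)
  also have "\<dots> \<le> norm (c *s z) * norm w"
    by (simp add: Re_herm norm_cauchy_schwarz)
  also have "\<dots> = norm z * norm w"
    using \<open>cmod c = 1\<close> by (simp add: norm_smult_vec)
  finally show ?thesis .
qed simp

lemma bounded_linear_herm: "bounded_linear (\<lambda>z. herm z w)"
  unfolding herm_def
  by (intro bounded_linear_sum bounded_linear_mult_const bounded_linear_vec_nth)

lemma bounded_linear_smult_vec: "bounded_linear (\<lambda>c. c *s (v :: complex ^ 'n))"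
proof (rule bounded_linear_intro)
  show "norm (c *s v) \<le> norm c * norm v" for c by (simp add: norm_smult_vec)
qed (simp_all add: vec_eq_iff distrib_right)

lemma continuous_on_smult_vec [continuous_intros]:
  fixes g :: "'a::topological_space \<Rightarrow> complex ^ 'n"
  assumes "continuous_on S c" "continuous_on S g"
  shows "continuous_on S (\<lambda>x. c x *s g x)"
  unfolding vector_scalar_mult_def
  by (intro continuous_on_vec_lambda continuous_intros assms continuous_on_component)

lemma continuous_on_herm [continuous_intros]:
  fixes g :: "'a::topological_space \<Rightarrow> complex ^ 'n"
  assumes "continuous_on S f" "continuous_on S g"
  shows "continuous_on S (\<lambda>x. herm (f x) (g x))"
  unfolding herm_def
  by (intro continuous_intros assms continuous_on_component)

text \<open>For a unit vector \<open>e\<close> this is the map acting as the scalar \<open>a\<close>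
  on the complex line of \<open>e\<close> and as \<open>b\<close> on its orthogonal complement. The
  choice a = 1 rotates the complement, b = 1 rotates the line, and a = -1, b = 1 is the reflection
  in the complement.\<close>

definition axial :: "complex \<Rightarrow> complex \<Rightarrow> complex ^ 'n \<Rightarrow> complex ^ 'n \<Rightarrow> complex ^ 'n" where
  "axial a b e z = (a * herm z e) *s e + b *s (z - herm z e *s e)"

lemma herm_complement [simp]:
  assumes "norm e = 1"
  shows "herm (z - herm z e *s e) e = 0"
  using assms by (simp add: herm_diff_left herm_smult_left herm_self)

lemma herm_axial:
  assumes "norm e = 1"
  shows "herm (axial a b e z) e = a * herm z e"
  using assms by (simp add: axial_def herm_add_left herm_diff_left herm_smult_left herm_self)

lemma norm_decompose:
  assumes "norm e = 1"
  shows "(norm z)\<^sup>2 = (cmod (herm z e))\<^sup>2 + (norm (z - herm z e *s e))\<^sup>2"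
proof -
  have "herm (herm z e *s e) (z - herm z e *s e) = 0"
    using herm_complement[OF assms, of z] by (simp add: herm_smult_left herm_orthogonal_commute[of e])
  from norm_add_herm_orthogonal[OF this] show ?thesis
    using assms by (simp add: norm_smult_vec)
qed

lemma orthogonal_transformation_axial:
  assumes e: "norm e = 1" and "cmod a = 1" "cmod b = 1"
  shows "orthogonal_transformation (axial a b e)"
  unfolding orthogonal_transformation
proof (intro conjI allI)
  show "linear (axial a b e)"
    by (rule linearI)
       (simp_all add: axial_def herm_add_left herm_scaleR_left vec_eq_iff algebra_simps
         scaleR_conv_of_real[where 'a = complex])
next
  fix z
  have *: "axial a b e z - herm (axial a b e z) e *s e = b *s (z - herm z e *s e)"
    using herm_axial[OF e] by (simp add: axial_def)
  have "(norm (axial a b e z))\<^sup>2 = (norm z)\<^sup>2"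
    unfolding norm_decompose[OF e, of "axial a b e z"] *
    using assms norm_decompose[OF e, of z] by (simp add: herm_axial norm_smult_vec norm_mult del: vector_ssub_ldistrib)
  then show "norm (axial a b e z) = norm z"
    by (simp add: power2_eq_iff_nonneg)
qed

text \<open>A reflection carries a unit vector to any other unit vector, up to a phase.\<close>

lemma exists_orthogonal_transformation_herm:
  fixes e e' :: "complex ^ 'n"
  assumes e: "norm e = 1" and e': "norm e' = 1"
  obtains T where "orthogonal_transformation T" "\<And>z. cmod (herm (T z) e') = cmod (herm z e)"
proof -
  \<comment> \<open>The phase \<open>c\<close> makes \<open>herm e f\<close> real and nonnegative; a
    reflection in the complement of e - f exchanges \<open>e\<close> and \<open>f\<close> only if
    that product is real.\<close>
  define c where "c = (if herm e e' = 0 then 1 else sgn (herm e e'))"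
  have c: "cmod c = 1" by (simp add: c_def norm_sgn)
  define f where "f = c *s e'"
  have f: "norm f = 1" using c e' by (simp add: f_def norm_smult_vec)
  have ef: "herm e f = of_real (cmod (herm e e'))"
    by (simp add: f_def herm_smult_right c_def sgn_div_norm scaleR_conv_of_real)
       (simp add: complex_norm_square[symmetric] power2_eq_square field_simps mult.commute)
  have hf: "cmod (herm z e') = cmod (herm z f)" for z
    using c by (simp add: f_def herm_smult_right norm_mult)
  show ?thesis
  proof (cases "e = f")
    case True
    show ?thesis
      by (rule that[OF orthogonal_transformation_id]) (simp add: hf True)
  next
    case False
    define N where "N = norm (e - f)"
    have N: "N > 0" using False by (simp add: N_def)
    define u where "u = complex_of_real (1 / N) *s (e - f)"
    have u: "norm u = 1" using N by (simp add: u_def norm_smult_vec norm_divide N_def del: vector_ssub_ldistrib)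
    define \<rho> where "\<rho> = cmod (herm e e')"
    have fe: "herm f e = of_real \<rho>" using ef herm_commute[of f e] by (simp add: \<rho>_def)
    have "complex_of_real (N\<^sup>2) = herm (e - f) (e - f)"
      unfolding N_def herm_self ..
    also have "\<dots> = 2 - 2 * of_real \<rho>"
      unfolding herm_diff_left herm_diff_right ef fe by (simp add: herm_self e f \<rho>_def)
    finally have N2: "complex_of_real N * of_real N = 2 - 2 * of_real \<rho>"
      by (simp add: power2_eq_square)
    \<comment> \<open>The reflection is self-adjoint and sends \<open>f\<close> to
      \<open>e\<close>.\<close>
    have "herm (axial (-1) 1 u z) f = herm z e" for z
    proof -
      have "herm (axial (-1) 1 u z) f = herm z f - 2 * herm z u * herm u f"
        by (simp only: axial_def herm_add_left herm_diff_left herm_smult_left) (simp add: algebra_simps)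
      also have "herm z u = (herm z e - herm z f) / of_real N"
        by (simp add: u_def herm_smult_right herm_diff_right diff_divide_distrib)
      also have "herm u f = (of_real \<rho> - 1) / of_real N"
        using f by (simp add: u_def herm_smult_left herm_diff_left ef herm_self \<rho>_def diff_divide_distrib)
      also have "herm z f - 2 * ((herm z e - herm z f) / of_real N) * ((of_real \<rho> - 1) / of_real N) =
          herm z f + (herm z e - herm z f) * ((2 - 2 * of_real \<rho>) / (of_real N * of_real N))"
        using N by (simp add: field_simps)
      also have "\<dots> = herm z e"
        unfolding N2[symmetric] using N by simp
      finally show ?thesis .
    qed
    then show ?thesis
      using orthogonal_transformation_axial[OF u, of "-1" 1] by (intro that[of "axial (-1) 1 u"]) (auto simp: hf)
  qed
qed

section \<open>Circle means of holomorphic functions\<close>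

lemma circlepath_cis: "circlepath z s x = z + of_real s * cis (2 * pi * x)"
  by (simp add: circlepath cis_conv_exp mult_ac)

lemma contour_integral_circlepath_integral:
  "contour_integral (circlepath z s) f =
   integral {0..1} (\<lambda>x. f (z + of_real s * cis (2 * pi * x)) * (2 * of_real pi * \<i> * of_real s * cis (2 * pi * x)))"
  unfolding contour_integral_integral
  by (intro integral_cong) (simp add: vector_derivative_circlepath circlepath_cis cis_conv_exp mult_ac)

lemma contour_integral_circlepath_mean:
  assumes "s > 0"
  shows "contour_integral (circlepath 0 s) (\<lambda>u. \<phi> u / u) =
    2 * of_real pi * \<i> * integral {0..1} (\<lambda>x. \<phi> (of_real s * cis (2 * pi * x)))"
proof -
  have "contour_integral (circlepath 0 s) (\<lambda>u. \<phi> u / u) =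
      integral {0..1} (\<lambda>x. 2 * of_real pi * \<i> * \<phi> (of_real s * cis (2 * pi * x)))"
    unfolding contour_integral_circlepath_integral
    using assms by (intro integral_cong) (simp add: field_simps)
  then show ?thesis by simp
qed

text \<open>Up to the factor 2 pi i the mean is the contour integral of \<phi>(u)/u, and concentric
  circles are homotopic in the annulus between them. For s = 0 the annulus is a full disc and
  Cauchy's formula gives the value at the centre; this case later links averages to values of f on
  the axis.\<close>

lemma circle_mean_eq:
  assumes hol: "\<phi> holomorphic_on S" and S: "open S"
    and s: "0 \<le> s" "s \<le> s'"
    and sub: "\<And>u. s \<le> cmod u \<Longrightarrow> cmod u \<le> s' \<Longrightarrow> u \<in> S"
  shows "integral {0..1} (\<lambda>x. \<phi> (of_real s * cis (2 * pi * x))) =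
         integral {0..1} (\<lambda>x. \<phi> (of_real s' * cis (2 * pi * x)))"
proof -
  consider "s' = 0" | "s = 0" "s' > 0" | "s > 0" using s by linarith
  then show ?thesis
  proof cases
    case 1
    with s show ?thesis by simp
  next
    case 2
    then have "cball 0 s' \<subseteq> S" using sub by auto
    then have "((\<lambda>u. \<phi> u / (u - 0)) has_contour_integral (2 * of_real pi * \<i> * \<phi> 0)) (circlepath 0 s')"
      using hol 2 by (intro Cauchy_integral_circlepath_simple) (auto intro: holomorphic_on_subset)
    then have "contour_integral (circlepath 0 s') (\<lambda>u. \<phi> u / u) = 2 * of_real pi * \<i> * \<phi> 0"
      by (simp add: contour_integral_unique)
    then show ?thesis
      using 2 by (simp add: contour_integral_circlepath_mean)
  next
    case 3
    then have s': "s' > 0" using s by simp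
    have "contour_integral (circlepath 0 s) (\<lambda>u. \<phi> u / u) = contour_integral (circlepath 0 s') (\<lambda>u. \<phi> u / u)"
    proof (rule Cauchy_theorem_homotopic_loops)
      show "open (S - {0})" using S by auto
      show "(\<lambda>u. \<phi> u / u) holomorphic_on S - {0}"
        using hol by (intro holomorphic_intros) (auto intro: holomorphic_on_subset)
      show "homotopic_loops (S - {0}) (circlepath 0 s) (circlepath 0 s')"
      proof (rule homotopic_loops_linear)
        fix t :: real
        show "closed_segment (circlepath 0 s t) (circlepath 0 s' t) \<subseteq> S - {0}"
        proof
          fix y assume "y \<in> closed_segment (circlepath 0 s t) (circlepath 0 s' t)"
          then obtain u where u: "0 \<le> u" "u \<le> 1" and
            "y = (1 - u) *\<^sub>R (of_real s * cis (2 * pi * t)) + u *\<^sub>R (of_real s' * cis (2 * pi * t))"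
            by (auto simp: in_segment circlepath_cis)
          then have y: "y = of_real ((1 - u) * s + u * s') * cis (2 * pi * t)"
            by (simp add: scaleR_conv_of_real algebra_simps)
          have "(1 - u) * s + u * s' = s + u * (s' - s)" by (simp add: algebra_simps)
          then have "s \<le> (1 - u) * s + u * s'"
            using u s by simp
          moreover have "(1 - u) * s + u * s' = s' - (1 - u) * (s' - s)" by (simp add: algebra_simps)
          then have "(1 - u) * s + u * s' \<le> s'"
            using u s by simp
          moreover have "cmod y = \<bar>(1 - u) * s + u * s'\<bar>"
            unfolding y norm_mult norm_of_real by simp
          ultimately have "s \<le> cmod y" "cmod y \<le> s'"
            using 3 by linarith+
          then show "y \<in> S - {0}" using sub[of y] 3 by auto
        qed
      qed auto
    qed auto
    then show ?thesis
      using 3 s' by (simp add: contour_integral_circlepath_mean)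
  qed
qed

text \<open>Differentiation under the integral needs a jointly continuous derivative, although only
  \<open>g\<close> itself is assumed continuous. Cauchy's formula expresses the derivative as an
  integral of \<open>g\<close> over a circle and so supplies the continuity.\<close>

lemma holomorphic_on_parametric_integral:
  fixes g :: "complex \<Rightarrow> real \<Rightarrow> complex"
  assumes S: "open S"
    and cont: "continuous_on (S \<times> {0..1}) (\<lambda>(\<zeta>, t). g \<zeta> t)"
    and hol: "\<And>t. t \<in> {0..1} \<Longrightarrow> (\<lambda>\<zeta>. g \<zeta> t) holomorphic_on S"
  shows "(\<lambda>\<zeta>. integral {0..1} (g \<zeta>)) holomorphic_on S"
proof -
  have "(\<lambda>\<zeta>. integral {0..1} (g \<zeta>)) field_differentiable (at \<zeta>0)" if "\<zeta>0 \<in> S" for \<zeta>0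
  proof -
    obtain \<rho> where \<rho>: "\<rho> > 0" "cball \<zeta>0 \<rho> \<subseteq> S"
      using S \<open>\<zeta>0 \<in> S\<close> by (meson open_contains_cball)
    let ?c = "\<lambda>x. \<zeta>0 + of_real \<rho> * cis (2 * pi * x)"
    have c: "?c x \<in> S" for x
      using \<rho> by (auto simp: norm_mult dist_norm intro!: subsetD[OF \<rho>(2)])
    define fx where "fx = (\<lambda>\<zeta> t. 1 / (2 * of_real pi * \<i>) *
       integral (cbox 0 1) (\<lambda>x. g (?c x) t / (?c x - \<zeta>)\<^sup>2 * (2 * of_real pi * \<i> * of_real \<rho> * cis (2 * pi * x))))"
    have ne: "?c x \<noteq> \<zeta>" if "\<zeta> \<in> ball \<zeta>0 \<rho>" for \<zeta> x
    proof
      assume "?c x = \<zeta>"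
      then have "dist \<zeta>0 \<zeta> = \<rho>" using \<rho>(1) by (auto simp: dist_norm norm_mult)
      then show False using that by simp
    qed
    have gc: "continuous_on A (\<lambda>y. g (h y) (k y))"
      if "continuous_on A h" "continuous_on A k" "\<And>y. y \<in> A \<Longrightarrow> h y \<in> S" "\<And>y. y \<in> A \<Longrightarrow> k y \<in> {0..1}"
      for A :: "((complex \<times> real) \<times> real) set" and h k
    proof -
      have "continuous_on A (\<lambda>y. (h y, k y))"
        using that by (intro continuous_on_Pair)
      moreover have "(\<lambda>y. (h y, k y)) ` A \<subseteq> S \<times> {0..1}"
        using that(3,4) by blast
      ultimately show ?thesis
        using continuous_on_compose2[OF cont, of A "\<lambda>y. (h y, k y)"] by simp
    qed
    have "(\<lambda>\<zeta>. integral (cbox 0 1) (g \<zeta>)) holomorphic_on ball \<zeta>0 \<rho>"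
    proof (rule leibniz_rule_holomorphic)
      show "((\<lambda>x. g x t) has_field_derivative fx x t) (at x within ball \<zeta>0 \<rho>)"
        if "x \<in> ball \<zeta>0 \<rho>" "t \<in> cbox 0 1" for x t
      proof -
        have "(\<lambda>\<zeta>. g \<zeta> t) holomorphic_on cball \<zeta>0 \<rho>"
          using hol[of t] that \<rho>(2) by (auto intro: holomorphic_on_subset)
        then have "((\<lambda>x. g x t) has_field_derivative (1 / (2 * of_real pi * \<i>) *
            contour_integral (circlepath \<zeta>0 \<rho>) (\<lambda>u. g u t / (u - x)^2))) (at x)"
          using that by (intro Cauchy_derivative_integral_circlepath(2))
            (auto intro: holomorphic_on_imp_continuous_on holomorphic_on_subset)
        then show ?thesis
          by (simp add: contour_integral_circlepath_integral fx_def has_field_derivative_at_within)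
      qed
      show "g x integrable_on cbox 0 1" if "x \<in> ball \<zeta>0 \<rho>" for x
      proof (rule integrable_continuous)
        have "x \<in> S" using that \<rho>(2) by auto
        then have "Pair x ` {0..1} \<subseteq> S \<times> {0..1}" by blast
        moreover have "continuous_on {0..1::real} (Pair x)"
          by (intro continuous_intros)
        ultimately show "continuous_on (cbox 0 1) (g x)"
          using continuous_on_compose2[OF cont, of "{0..1}" "Pair x"] by simp
      qed
      have "continuous_on (ball \<zeta>0 \<rho> \<times> cbox 0 1) (\<lambda>p. fx (fst p) (snd p))"
        unfolding fx_def using ne
        by (intro continuous_intros integral_continuous_on_param)
           (auto simp: case_prod_beta' intro!: continuous_intros gc c)
      then show "continuous_on (ball \<zeta>0 \<rho> \<times> cbox 0 1) (\<lambda>(x, t). fx x t)"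
        by (simp add: case_prod_beta')
    qed auto
    then show ?thesis
      using \<rho>(1) by (auto simp: holomorphic_on_open field_differentiable_def)
  qed
  then show ?thesis
    by (auto simp: holomorphic_on_def intro: field_differentiable_at_within)
qed

text \<open>The Fourier coefficients of F on the circle through \<zeta> are its Taylor terms at
  \<zeta>: on the unit circle the conjugate power is a reciprocal power, so this is Cauchy's formula
  for u -> F(\<zeta> u).\<close>

lemma circle_mean_Taylor:
  assumes F: "F holomorphic_on ball 0 1" and \<zeta>: "cmod \<zeta> < 1"
  shows "integral {0..1} (\<lambda>x. F (cis (2 * pi * x) * \<zeta>) * cnj (cis (2 * pi * x) ^ k)) =
         (deriv ^^ k) F 0 / fact k * \<zeta> ^ k"
proof -
  \<comment> \<open>A radius beyond 1 at which \<zeta> u still stays in the unit disc, so that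
    \<open>?\<phi>\<close> is holomorphic around the closed unit disc.\<close>
  obtain R where R: "R > 1" "cmod \<zeta> * R < 1"
  proof (cases "\<zeta> = 0")
    case True then show ?thesis using that[of 2] by simp
  next
    case False
    then have "1 < inverse (cmod \<zeta>)" using \<zeta> by (simp add: one_less_inverse)
    then obtain R where "1 < R" "R < inverse (cmod \<zeta>)" using dense by blast
    then show ?thesis using that[of R] False by (simp add: field_simps)
  qed
  let ?\<phi> = "\<lambda>u. F (\<zeta> * u)"
  have im: "\<zeta> * u \<in> ball 0 1" if "u \<in> ball 0 R" for u
  proof -
    have "cmod \<zeta> * cmod u \<le> cmod \<zeta> * R" using that by (intro mult_left_mono) auto
    then show ?thesis using R by (simp add: norm_mult)
  qed
  have hol: "?\<phi> holomorphic_on ball 0 R"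
    using holomorphic_on_compose_gen[of "\<lambda>u. \<zeta> * u" "ball 0 R" F "ball 0 1"] F im
    by (force simp: o_def intro!: holomorphic_intros)
  have "((\<lambda>u. ?\<phi> u / (u - 0) ^ (Suc k)) has_contour_integral ((2 * pi * \<i>) / (fact k) * (deriv ^^ k) ?\<phi> 0))
           (circlepath 0 1)"
    using hol R
    by (intro Cauchy_has_contour_integral_higher_derivative_circlepath)
       (auto intro!: holomorphic_on_imp_continuous_on elim!: holomorphic_on_subset)
  then have "contour_integral (circlepath 0 1) (\<lambda>u. (?\<phi> u / u ^ k) / u) = (2 * pi * \<i>) / (fact k) * (deriv ^^ k) ?\<phi> 0"
    by (simp add: contour_integral_unique mult.commute)
  then have *: "integral {0..1} (\<lambda>x. ?\<phi> (cis (2 * pi * x)) / cis (2 * pi * x) ^ k) = (deriv ^^ k) ?\<phi> 0 / fact k"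
    by (subst (asm) contour_integral_circlepath_mean) (simp_all add: field_simps)
  have "(deriv ^^ k) ?\<phi> 0 = \<zeta> ^ k * (deriv ^^ k) F (\<zeta> * 0)"
    using R im by (intro higher_deriv_compose_linear[OF F, of "ball 0 R"]) auto
  moreover have "cnj (cis y ^ k) = 1 / cis y ^ k" for y
    by (simp add: cis_cnj divide_inverse power_inverse flip: cis_inverse)
  ultimately show ?thesis
    using * by (simp add: mult.commute)
qed

section \<open>Hartogs' phenomenon on spherical shells\<close>

text \<open>With r = 0 the origin would be missing, so the ball needs a negative parameter.\<close>

definition shell :: "real \<Rightarrow> (complex ^ 'n) set" where
  "shell r = {z. r < norm z \<and> norm z < 1}"

lemma open_shell: "open (shell r)"
  unfolding shell_def by (intro open_Collect_conj open_Collect_less continuous_intros)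

lemma holomorphic_vec_on_slice:
  assumes f: "holomorphic_vec_on f D"
  shows "(\<lambda>x. f (a + x *s v)) holomorphic_on {x. a + x *s v \<in> D}"
proof (rule holomorphic_onI)
  fix x assume "x \<in> {x. a + x *s v \<in> D}"
  then obtain f' where f': "(f has_derivative f') (at (a + x *s v))" "\<And>c v. f' (c *s v) = c * f' v"
    using f by (auto simp: holomorphic_vec_on_def)
  have "((\<lambda>x. a + x *s v) has_derivative (\<lambda>h. h *s v)) (at x)"
    using bounded_linear_imp_has_derivative[OF bounded_linear_smult_vec, of v]
    by (auto intro!: derivative_eq_intros)
  from has_derivative_compose[OF this f'(1)]
  have "((\<lambda>x. f (a + x *s v)) has_field_derivative f' v) (at x)"
    by (simp add: has_field_derivative_def f'(2) mult_commute_abs)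
  then show "(\<lambda>x. f (a + x *s v)) field_differentiable at x within {x. a + x *s v \<in> D}"
    using field_differentiable_at_within field_differentiable_def by blast
qed

lemma holomorphic_vec_on_imp_continuous_on:
  "holomorphic_vec_on f D \<Longrightarrow> continuous_on D f"
  unfolding holomorphic_vec_on_def
  by (meson continuous_at_imp_continuous_on has_derivative_continuous)

lemma norm_orthonormal_combination:
  assumes "norm e = 1" "norm v = 1" "herm v e = 0"
  shows "norm (\<zeta> *s e + \<mu> *s v) = sqrt ((cmod \<zeta>)\<^sup>2 + (cmod \<mu>)\<^sup>2)"
proof -
  have "herm (\<zeta> *s e) (\<mu> *s v) = 0"
    using assms herm_orthogonal_commute[of e v] by (simp add: herm_smult_left herm_smult_right)
  from norm_add_herm_orthogonal[OF this] show ?thesis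
    using assms by (simp add: norm_smult_vec real_sqrt_unique)
qed

text \<open>
  Hartogs' phenomenon: rotating the component of \<open>z\<close> orthogonal to \<open>e\<close> and averaging yields a
  holomorphic function of \<open>herm z e\<close> alone, because the average over a circle does not depend on
  its radius, which can be chosen so large that the circle avoids the hole of the shell.
\<close>

lemma hartogs_average:
  fixes f :: "complex ^ 'n \<Rightarrow> complex"
  assumes hol: "holomorphic_vec_on f (shell r)" and r: "r < 1"
    and e: "norm e = 1" and u: "norm u = 1" "herm u e = 0"
  obtains F where "F holomorphic_on ball 0 1"
    "\<And>z. z \<in> shell r \<Longrightarrow> integral {0..1} (\<lambda>x. f (axial 1 (cis (2 * pi * x)) e z)) = F (herm z e)"
    "\<And>\<zeta>. r < cmod \<zeta> \<Longrightarrow> cmod \<zeta> < 1 \<Longrightarrow> F \<zeta> = f (\<zeta> *s e)"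
proof -
  \<comment> \<open>\<open>N \<zeta> s\<close> is the common norm of the points on the circle of
    radius \<open>s\<close> about \<zeta> e in a direction orthogonal to \<open>e\<close>, and
    \<open>M\<close> is the mean of f over such a circle.\<close>
  define N where "N = (\<lambda>\<zeta> s. sqrt ((cmod \<zeta>)\<^sup>2 + s\<^sup>2))"
  define M where "M = (\<lambda>v \<zeta> s. integral {0..1} (\<lambda>x. f (\<zeta> *s e + (of_real s * cis (2 * pi * x)) *s v)))"
  have in_shell: "\<zeta> *s e + \<mu> *s v \<in> shell r \<longleftrightarrow> r < N \<zeta> (cmod \<mu>) \<and> N \<zeta> (cmod \<mu>) < 1"
    if "norm v = 1" "herm v e = 0" for \<zeta> \<mu> v
    using that by (simp add: shell_def norm_orthonormal_combination[OF e] N_def)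
  have contf: "continuous_on (shell r) f"
    using holomorphic_vec_on_imp_continuous_on[OF hol] .

  \<comment> \<open>\<open>N\<close> increases with the radius, so every radius between two
    admissible ones is admissible and the circle can be moved without leaving the shell.\<close>
  have radius: "M v \<zeta> s = M v \<zeta> s'"
    if v: "norm v = 1" "herm v e = 0" and "0 \<le> s" "s \<le> s'" and N: "r < N \<zeta> s" "N \<zeta> s' < 1" for v \<zeta> s s'
    unfolding M_def
  proof (rule circle_mean_eq)
    let ?S = "{x. \<zeta> *s e + x *s v \<in> shell r}"
    show "(\<lambda>x. f (\<zeta> *s e + x *s v)) holomorphic_on ?S"
      by (rule holomorphic_vec_on_slice[OF hol])
    have "open ((\<lambda>x. \<zeta> *s e + x *s v) -` shell r)"
      by (intro open_vimage open_shell continuous_intros)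
    then show "open ?S" by (simp add: vimage_def)
    show "x \<in> ?S" if "s \<le> cmod x" "cmod x \<le> s'" for x
    proof -
      have "N \<zeta> s \<le> N \<zeta> (cmod x)" "N \<zeta> (cmod x) \<le> N \<zeta> s'"
        unfolding N_def using that \<open>0 \<le> s\<close> by (auto intro!: power_mono)
      then show ?thesis using N in_shell[OF v] by auto
    qed
  qed (use that in auto)
  then have radius: "M v \<zeta> s = M v \<zeta> s'"
    if "norm v = 1" "herm v e = 0" "0 \<le> s" "0 \<le> s'" "r < N \<zeta> s" "N \<zeta> s < 1" "r < N \<zeta> s'" "N \<zeta> s' < 1"
    for v \<zeta> s s'
    using that by (metis linear)

  have holM: "(\<lambda>\<zeta>. M v \<zeta> s) holomorphic_on {\<zeta>. r < N \<zeta> s \<and> N \<zeta> s < 1}"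
    if v: "norm v = 1" "herm v e = 0" and s: "0 \<le> s" for v s
    unfolding M_def
  proof (rule holomorphic_on_parametric_integral)
    let ?S = "{\<zeta>. r < N \<zeta> s \<and> N \<zeta> s < 1}"
    show "open ?S" unfolding N_def
      by (intro open_Collect_conj open_Collect_less continuous_intros)
    have mem: "\<zeta> *s e + (of_real s * cis t) *s v \<in> shell r \<longleftrightarrow> \<zeta> \<in> ?S" for \<zeta> t
      using in_shell[OF v] s by (simp add: norm_mult)
    have "continuous_on (?S \<times> {0..1}) (\<lambda>p. f (fst p *s e + (of_real s * cis (2 * pi * snd p)) *s v))"
      using mem by (intro continuous_on_compose2[OF contf] continuous_intros) auto
    then show "continuous_on (?S \<times> {0..1}) (\<lambda>(\<zeta>, x). f (\<zeta> *s e + (of_real s * cis (2 * pi * x)) *s v))"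
      by (simp add: case_prod_beta')
    show "(\<lambda>\<zeta>. f (\<zeta> *s e + (of_real s * cis (2 * pi * t)) *s v)) holomorphic_on ?S" for t
      using holomorphic_vec_on_slice[OF hol, of "(of_real s * cis (2 * pi * t)) *s v" e] mem
      by (simp add: add.commute)
  qed

  obtain \<rho> where \<rho>: "max r 0 < \<rho>" "\<rho> < 1" using r dense[of "max r 0" 1] by auto
  \<comment> \<open>This radius gives norm squared \<rho>^2 + (1 - \<rho>^2) |\<zeta>|^2, which lies
    in [\<rho>^2, 1): the circle avoids the hole for every \<zeta> in the unit disc, including
    |\<zeta>| <= r.\<close>
  define s where "s = (\<lambda>\<zeta>. \<rho> * sqrt (1 - (cmod \<zeta>)\<^sup>2))"
  have s: "0 \<le> s \<zeta>" "r < N \<zeta> (s \<zeta>)" "N \<zeta> (s \<zeta>) < 1" if "\<zeta> \<in> ball 0 1" for \<zeta>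
  proof -
    have 1: "(cmod \<zeta>)\<^sup>2 < 1" using that by (simp add: power_less_one_iff)
    show "0 \<le> s \<zeta>" using 1 \<rho> by (simp add: s_def)
    have eq: "(cmod \<zeta>)\<^sup>2 + (s \<zeta>)\<^sup>2 = \<rho>\<^sup>2 + (1 - \<rho>\<^sup>2) * (cmod \<zeta>)\<^sup>2"
      using 1 by (simp add: s_def power_mult_distrib algebra_simps)
    have 2: "\<rho>\<^sup>2 < 1" using \<rho> by (simp add: power_less_one_iff)
    then have "\<rho>\<^sup>2 \<le> (cmod \<zeta>)\<^sup>2 + (s \<zeta>)\<^sup>2"
      unfolding eq by simp
    then have "\<rho> \<le> N \<zeta> (s \<zeta>)" unfolding N_def by (rule real_le_rsqrt)
    then show "r < N \<zeta> (s \<zeta>)" using \<rho> by linarith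
    have "(1 - \<rho>\<^sup>2) * (cmod \<zeta>)\<^sup>2 < (1 - \<rho>\<^sup>2) * 1"
      using 1 2 by (intro mult_strict_left_mono) auto
    then show "N \<zeta> (s \<zeta>) < 1" unfolding N_def eq by simp
  qed
  define G where "G = (\<lambda>v \<zeta>. M v \<zeta> (s \<zeta>))"
  \<comment> \<open>The radius \<open>s \<zeta>\<close> does not depend holomorphically on \<zeta>.
    Near a point \<zeta>0 it can be frozen at \<open>s \<zeta>0\<close>, because the mean is the
    same for all admissible radii.\<close>
  have holG: "G v holomorphic_on ball 0 1" if v: "norm v = 1" "herm v e = 0" for v
  proof -
    have "G v field_differentiable (at \<zeta>0)" if "\<zeta>0 \<in> ball 0 1" for \<zeta>0
    proof -
      let ?U = "{\<zeta>. r < N \<zeta> (s \<zeta>0) \<and> N \<zeta> (s \<zeta>0) < 1} \<inter> ball 0 1"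
      have U: "open ?U" unfolding N_def
        by (intro open_Int open_Collect_conj open_Collect_less continuous_intros) auto
      have "(\<lambda>\<zeta>. M v \<zeta> (s \<zeta>0)) holomorphic_on ?U"
        using holM[OF v s(1)[OF that]] by (rule holomorphic_on_subset) auto
      moreover have "M v \<zeta> (s \<zeta>0) = G v \<zeta>" if "\<zeta> \<in> ?U" for \<zeta>
        unfolding G_def using that s s(1)[OF \<open>\<zeta>0 \<in> ball 0 1\<close>] by (intro radius v) auto
      ultimately have "G v holomorphic_on ?U"
        by (rule holomorphic_transform)
      moreover have "\<zeta>0 \<in> ?U" using that s by auto
      ultimately show ?thesis
        using U holomorphic_on_imp_differentiable_at by blast
    qed
    then show ?thesis by (auto simp: holomorphic_on_def intro: field_differentiable_at_within)
  qed
  have Gf: "G v \<zeta> = f (\<zeta> *s e)"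
    if v: "norm v = 1" "herm v e = 0" and \<zeta>: "r < cmod \<zeta>" "cmod \<zeta> < 1" for v \<zeta>
  proof -
    have "G v \<zeta> = M v \<zeta> 0"
      unfolding G_def using s[of \<zeta>] \<zeta> by (intro radius v) (auto simp: N_def)
    then show ?thesis by (simp add: M_def)
  qed
  \<comment> \<open>Shrinking the circle to radius 0 shows that every direction gives f(\<zeta> e)
    for r < |\<zeta>| < 1; the identity theorem extends the agreement to the disc.\<close>
  have GG: "G v \<zeta> = G u \<zeta>" if v: "norm v = 1" "herm v e = 0" and \<zeta>: "\<zeta> \<in> ball 0 1" for v \<zeta>
  proof (rule analytic_continuation_open[of "{\<zeta>. r < cmod \<zeta> \<and> cmod \<zeta> < 1}" "ball 0 1" "G v" "G u"])
    show "open {\<zeta>. r < cmod \<zeta> \<and> cmod \<zeta> < 1}"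
      by (intro open_Collect_conj open_Collect_less continuous_intros)
    have "of_real \<rho> \<in> {\<zeta>. r < cmod \<zeta> \<and> cmod \<zeta> < 1}" using \<rho> by auto
    then show "{\<zeta>. r < cmod \<zeta> \<and> cmod \<zeta> < 1} \<noteq> {}" by blast
  qed (use \<zeta> Gf[OF v] Gf[OF u] holG[OF v] holG[OF u] in auto)
  show ?thesis
  proof (rule that)
    show "G u holomorphic_on ball 0 1" using holG[OF u] .
    show "G u \<zeta> = f (\<zeta> *s e)" if "r < cmod \<zeta>" "cmod \<zeta> < 1" for \<zeta>
      using Gf[OF u that] .
    show "integral {0..1} (\<lambda>x. f (axial 1 (cis (2 * pi * x)) e z)) = G u (herm z e)"
      if z: "z \<in> shell r" for z
    proof (cases "z - herm z e *s e = 0")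
      case True
      then have ze: "z = herm z e *s e" by simp
      then have nz: "norm z = cmod (herm z e)" using e norm_smult_vec[of "herm z e" e] by simp
      have "axial 1 b e z = herm z e *s e" for b
        unfolding axial_def True by simp
      then show ?thesis
        using Gf[OF u, of "herm z e"] z nz by (simp add: shell_def)
    next
      case False
      define w where "w = z - herm z e *s e"
      define v where "v = complex_of_real (1 / norm w) *s w"
      have w: "norm w > 0" using False by (simp add: w_def)
      have v: "norm v = 1" "herm v e = 0"
        using w herm_complement[OF e, of z]
        by (simp_all add: v_def norm_smult_vec norm_divide herm_smult_left w_def del: vector_ssub_ldistrib)
      have "axial 1 b e z = herm z e *s e + (of_real (norm w) * b) *s v" for b
        using w by (simp add: axial_def v_def w_def[symmetric] mult.commute)
      then have "integral {0..1} (\<lambda>x. f (axial 1 (cis (2 * pi * x)) e z)) = M v (herm z e) (norm w)"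
        by (simp add: M_def)
      also have "\<dots> = G v (herm z e)"
      proof -
        have Nz: "N (herm z e) (norm w) = norm z"
          by (simp add: N_def w_def flip: norm_decompose[OF e])
        have "cmod (herm z e) < 1"
          using norm_herm_le[of z e] e z by (simp add: shell_def)
        then show ?thesis
          unfolding G_def using z s[of "herm z e"] by (intro radius v) (auto simp: Nz shell_def)
      qed
      also have "\<dots> = G u (herm z e)"
        using norm_herm_le[of z e] e z by (intro GG v) (simp add: shell_def)
      finally show ?thesis .
    qed
  qed
qed

section \<open>Moments and averages over shells\<close>

lemma herm_less_one: "z \<in> shell r \<Longrightarrow> norm e = 1 \<Longrightarrow> cmod (herm z e) < 1"
  using norm_herm_le[of z e] by (simp add: shell_def)

lemma shell_borel [measurable]: "shell r \<in> sets borel"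
  by (simp add: open_shell borel_open)

lemma emeasure_shell_finite: "emeasure lborel (shell r :: (complex ^ 'n) set) < \<infinity>"
proof -
  have "emeasure lborel (shell r :: (complex ^ 'n) set) \<le> emeasure lborel (ball 0 1 :: (complex ^ 'n) set)"
    by (intro emeasure_mono) (auto simp: shell_def)
  then show ?thesis using emeasure_bounded_finite[OF bounded_ball[of "0 :: complex ^ 'n" 1]] by simp
qed

lemma set_integrable_shell_bounded:
  fixes g :: "complex ^ 'n \<Rightarrow> 'b::{banach, second_countable_topology}"
  assumes "continuous_on (shell r) g" "\<And>z. z \<in> shell r \<Longrightarrow> norm (g z) \<le> B"
  shows "set_integrable lborel (shell r) g"
  unfolding set_integrable_def
proof (rule integrableI_bounded_set[where A = "shell r" and B = B])
  show "(\<lambda>x. indicat_real (shell r) x *\<^sub>R g x) \<in> borel_measurable lborel"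
    using borel_measurable_continuous_on_indicator[OF shell_borel assms(1)] by simp
qed (use assms emeasure_shell_finite in \<open>auto split: split_indicator\<close>)

lemma set_integrable_shell_mult_bounded:
  fixes f g :: "complex ^ 'n \<Rightarrow> complex"
  assumes "set_integrable lborel (shell r) f" "continuous_on (shell r) g" "\<And>z. z \<in> shell r \<Longrightarrow> norm (g z) \<le> B"
  shows "set_integrable lborel (shell r) (\<lambda>z. f z * g z)"
  unfolding set_integrable_def
proof (rule Bochner_Integration.integrable_bound)
  have f: "integrable lborel (\<lambda>z. indicat_real (shell r) z *\<^sub>R f z)"
    using assms(1) by (simp add: set_integrable_def)
  then show "integrable lborel (\<lambda>z. B *\<^sub>R (indicat_real (shell r) z *\<^sub>R f z))"
    by (intro integrable_scaleR_right)
  have "(\<lambda>z. (indicat_real (shell r) z *\<^sub>R f z) * (indicat_real (shell r) z *\<^sub>R g z)) \<in> borel_measurable lborel"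
    using borel_measurable_continuous_on_indicator[OF shell_borel assms(2)] f
    by (intro borel_measurable_times) auto
  also have "(\<lambda>z. (indicat_real (shell r) z *\<^sub>R f z) * (indicat_real (shell r) z *\<^sub>R g z))
      = (\<lambda>z. indicat_real (shell r) z *\<^sub>R (f z * g z))"
    by (auto split: split_indicator)
  finally show "(\<lambda>z. indicat_real (shell r) z *\<^sub>R (f z * g z)) \<in> borel_measurable lborel" .
  have "norm (f z * g z) \<le> norm (B *\<^sub>R f z)" if "z \<in> shell r" for z
  proof -
    have "norm (f z) * norm (g z) \<le> norm (f z) * \<bar>B\<bar>"
      using assms(3)[OF that] by (intro mult_left_mono) auto
    then show ?thesis by (simp add: norm_mult mult.commute)
  qed
  then show "AE z in lborel. norm (indicat_real (shell r) z *\<^sub>R (f z * g z)) \<le> norm (B *\<^sub>R (indicat_real (shell r) z *\<^sub>R f z))"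
    by (auto split: split_indicator)
qed

text \<open>The shell has finite volume and |f| <= 1 + |f|^2.\<close>

lemma L2h_imp_set_integrable:
  assumes "f \<in> L2h (shell r)"
  shows "set_integrable lborel (shell r) f"
proof -
  have f: "holomorphic_vec_on f (shell r)" "set_integrable lborel (shell r) (\<lambda>z. (cmod (f z))\<^sup>2)"
    using assms by (auto simp: L2h_def)
  have "set_integrable lborel (shell r) (\<lambda>z. 1 + (cmod (f z))\<^sup>2)"
    using set_integrable_shell_bounded[of r "\<lambda>_. 1::real" 1] f(2) by (intro set_integral_add(1)) auto
  moreover have "set_borel_measurable lborel (shell r) f"
    using borel_measurable_continuous_on_indicator[OF shell_borel holomorphic_vec_on_imp_continuous_on[OF f(1)]]
    by (simp add: set_borel_measurable_def)
  moreover have "x \<le> \<bar>1 + x\<^sup>2\<bar>" for x :: real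
  proof -
    have "0 \<le> (1 - x)\<^sup>2 + 1 + x\<^sup>2" by simp
    then have "x \<le> 1 + x\<^sup>2" by (simp add: power2_eq_square algebra_simps)
    also have "\<dots> \<le> \<bar>1 + x\<^sup>2\<bar>" by (rule abs_ge_self)
    finally show ?thesis .
  qed
  ultimately show ?thesis
    by (intro set_integrable_bound[of lborel "shell r" "\<lambda>z. 1 + (cmod (f z))\<^sup>2" f]) auto
qed

lemma axial_in_shell_iff:
  assumes "norm e = 1" "cmod a = 1" "cmod b = 1"
  shows "axial a b e z \<in> shell r \<longleftrightarrow> z \<in> shell r"
  using orthogonal_transformation_axial[OF assms] by (simp add: shell_def orthogonal_transformation)

text \<open>Axial rotations preserve the shell, so the averaging result on the whole space applies
  to \<open>g\<close> extended by zero.\<close>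

lemma
  fixes g :: "complex ^ 'n \<Rightarrow> complex" and a b :: "real \<Rightarrow> complex"
  assumes e: "norm e = 1" and ab: "continuous_on UNIV a" "continuous_on UNIV b"
      "\<And>x. cmod (a x) = 1" "\<And>x. cmod (b x) = 1"
    and g: "continuous_on (shell r) g" "set_integrable lborel (shell r) g"
  shows shell_average_integral: "(LINT z:shell r|lborel. integral {0..1} (\<lambda>x. g (axial (a x) (b x) e z))) =
      (LINT z:shell r|lborel. g z)"
    and shell_average_integrable:
      "set_integrable lborel (shell r) (\<lambda>z. integral {0..1} (\<lambda>x. g (axial (a x) (b x) e z)))"
proof -
  let ?h = "\<lambda>z. indicat_real (shell r) z *\<^sub>R g z"
  let ?R = "\<lambda>x. axial (a x) (b x) e"
  have h: "integrable lborel ?h" using g(2) by (simp add: set_integrable_def)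
  have R: "orthogonal_transformation (?R x)" for x
    using orthogonal_transformation_axial[OF e] ab by blast
  have "continuous_on UNIV (\<lambda>p. ?R (fst p) (snd p))"
    unfolding axial_def
    by (intro continuous_intros continuous_on_compose2[OF ab(1)] continuous_on_compose2[OF ab(2)]) auto
  then have cont: "continuous_on UNIV (\<lambda>(x, z). ?R x z)" by (simp add: case_prod_beta')
  have eq: "(LINT x:{0..1}|lborel. ?h (?R x z)) = indicat_real (shell r) z *\<^sub>R integral {0..1} (\<lambda>x. g (?R x z))" for z
  proof (cases "z \<in> shell r")
    case True
    then have in': "?R x z \<in> shell r" for x using axial_in_shell_iff[OF e ab(3,4)] by simp
    have "continuous_on {0..1} (\<lambda>x. g (?R x z))"
      using in' unfolding axial_def
      by (intro continuous_on_compose2[OF g(1)] continuous_intros continuous_on_subset[OF ab(1)]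
          continuous_on_subset[OF ab(2)]) auto
    then have "set_integrable lborel {0..1} (\<lambda>x. g (?R x z))"
      unfolding set_integrable_def by (intro borel_integrable_compact compact_Icc)
    then have "(LINT x:{0..1}|lborel. g (?R x z)) = integral {0..1} (\<lambda>x. g (?R x z))"
      by (rule set_borel_integral_eq_integral)
    then show ?thesis using True in' by simp
  next
    case False
    then show ?thesis using axial_in_shell_iff[OF e ab(3,4)] by simp
  qed
  show "(LINT z:shell r|lborel. integral {0..1} (\<lambda>x. g (axial (a x) (b x) e z))) = (LINT z:shell r|lborel. g z)"
    using integral_orthogonal_average[OF R cont h, unfolded eq] by (simp only: set_lebesgue_integral_def)
  show "set_integrable lborel (shell r) (\<lambda>z. integral {0..1} (\<lambda>x. g (axial (a x) (b x) e z)))"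
    using integrable_orthogonal_average[OF R cont h, unfolded eq] by (simp only: set_integrable_def)
qed

text \<open>The squared L2 norm of the k-th power of z -> \<open>herm z e\<close>; its inverse is
  the k-th coefficient of the kernel.\<close>

definition moment :: "complex ^ 'n \<Rightarrow> real \<Rightarrow> nat \<Rightarrow> real" where
  "moment e r k = (LINT z:shell r|lborel. cmod (herm z e) ^ (2 * k))"

lemma set_integrable_moment:
  assumes "norm e = 1"
  shows "set_integrable lborel (shell r) (\<lambda>z. cmod (herm z e) ^ (2 * k))"
proof (rule set_integrable_shell_bounded[where B = 1])
  show "norm (cmod (herm z e) ^ (2 * k)) \<le> 1" if "z \<in> shell r" for z
    using herm_less_one[OF that assms] by (simp add: power_le_one)
qed (intro continuous_intros)

text \<open>Lets the kernel be written with one reference vector, although the reproducing property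
  at a point w is tested along the direction of w.\<close>

lemma moment_unit_eq:
  fixes e e' :: "complex ^ 'n"
  assumes e: "norm e = 1" and e': "norm e' = 1"
  shows "moment e r k = moment e' r k"
proof -
  obtain T where T: "orthogonal_transformation T" "\<And>z. cmod (herm (T z) e') = cmod (herm z e)"
    using exists_orthogonal_transformation_herm[OF e e'] by blast
  have "T z \<in> shell r \<longleftrightarrow> z \<in> shell r" for z
    using T(1) by (simp add: shell_def orthogonal_transformation)
  then have "moment e r k = (LINT z|lborel. indicat_real (shell r) (T z) *\<^sub>R cmod (herm (T z) e') ^ (2 * k))"
    unfolding moment_def set_lebesgue_integral_def T(2) by (simp add: indicator_def)
  also have "\<dots> = moment e' r k"
    using set_integrable_moment[OF e', of r k] unfolding moment_def set_lebesgue_integral_def set_integrable_def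
    by (intro integral_orthogonal_transformation[OF T(1)]) auto
  finally show ?thesis .
qed

text \<open>Near t e, with t < 1 larger than both r and q, there is a ball inside the shell,
  independent of k, on which the integrand is at least q^(2k).\<close>

lemma moment_lower_bound:
  fixes e :: "complex ^ 'n"
  assumes e: "norm e = 1" and r: "r < 1" and q: "0 < q" "q < 1"
  obtains C where "C > 0" "\<And>k. C * q ^ (2 * k) \<le> moment e r k"
proof -
  let ?W = "shell r \<inter> {z. q < cmod (herm z e)}"
  obtain t where t: "max r q < t" "t < 1" using r q dense[of "max r q" 1] by auto
  have "open ?W"
    by (intro open_Int open_shell open_Collect_less continuous_intros)
  moreover have "of_real t *s e \<in> ?W"
    using t q e by (auto simp: shell_def norm_smult_vec herm_smult_left herm_self)
  ultimately obtain d where d: "d > 0" "ball (of_real t *s e) d \<subseteq> ?W"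
    by (meson open_contains_ball)
  let ?B = "ball (complex_of_real t *s e) d"
  have fin: "emeasure lborel ?B < \<infinity>" by (rule emeasure_bounded_finite[OF bounded_ball])
  show ?thesis
  proof (rule that)
    show "0 < measure lborel ?B" using d by simp
    show "measure lborel ?B * q ^ (2 * k) \<le> moment e r k" for k
    proof -
      have "measure lborel ?B * q ^ (2 * k) = (LINT z|lborel. indicat_real ?B z * q ^ (2 * k))"
        by simp
      also have "\<dots> \<le> moment e r k"
        unfolding moment_def set_lebesgue_integral_def
      proof (rule integral_mono)
        show "integrable lborel (\<lambda>z. indicat_real ?B z * q ^ (2 * k))"
          using fin by (intro integrable_mult_left integrable_real_indicator) auto
        show "integrable lborel (\<lambda>z. indicat_real (shell r) z *\<^sub>R cmod (herm z e) ^ (2 * k))"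
          using set_integrable_moment[OF e] by (simp add: set_integrable_def)
        show "indicat_real ?B z * q ^ (2 * k) \<le> indicat_real (shell r) z *\<^sub>R cmod (herm z e) ^ (2 * k)" for z
        proof (cases "z \<in> ?B")
          case True
          then have "z \<in> ?W" using d by blast
          then show ?thesis using True q by (auto intro!: power_mono)
        qed simp
      qed
      finally show ?thesis .
    qed
  qed
qed

lemma moment_pos:
  assumes "norm e = 1" "r < 1"
  shows "moment e r k > 0"
proof -
  obtain C where C: "C > 0" "\<And>k. C * (1/2) ^ (2 * k) \<le> moment e r k"
    using moment_lower_bound[OF assms, of "1/2"] by auto
  then have "0 < C * (1/2) ^ (2 * k)" by simp
  also note C(2)[of k]
  finally show ?thesis .
qed

lemma summable_inverse_moment:
  assumes e: "norm e = 1" and r: "r < 1" and x: "0 \<le> x" "x < 1"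
  shows "summable (\<lambda>k. inverse (moment e r k) * x ^ k)"
proof -
  \<comment> \<open>The square of \<open>q\<close> is the midpoint of x and 1, so x / q^2 < 1 and a
    geometric series dominates.\<close>
  define q where "q = sqrt ((1 + x) / 2)"
  have q: "0 < q" "q < 1" "q\<^sup>2 = (1 + x) / 2" using x by (auto simp: q_def)
  obtain C where C: "C > 0" "\<And>k. C * q ^ (2 * k) \<le> moment e r k"
    using moment_lower_bound[OF e r q(1,2)] by auto
  have "inverse (moment e r k) * x ^ k \<le> inverse C * (x / q\<^sup>2) ^ k" for k
  proof -
    have "inverse (moment e r k) \<le> inverse (C * q ^ (2 * k))"
      using C q by (intro le_imp_inverse_le) auto
    then have "inverse (moment e r k) * x ^ k \<le> inverse (C * q ^ (2 * k)) * x ^ k"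
      using x by (intro mult_right_mono) auto
    also have "\<dots> = inverse C * (x / q\<^sup>2) ^ k"
      unfolding power_mult using q by (simp add: power_divide field_simps)
    finally show ?thesis .
  qed
  moreover have "norm (x / q\<^sup>2) < 1"
    using x by (simp add: q(3) field_simps)
  then have "summable (\<lambda>k. inverse C * (x / q\<^sup>2) ^ k)"
    by (intro summable_mult summable_geometric)
  moreover have "norm (inverse (moment e r k) * x ^ k) = inverse (moment e r k) * x ^ k" for k
    using x moment_pos[OF e r, of k] by (simp add: abs_mult)
  ultimately show ?thesis
    by - (rule summable_comparison_test'[where N = 0 and g = "\<lambda>k. inverse C * (x / q\<^sup>2) ^ k"], simp_all)
qed

text \<open>Two averages. Rotating the complement of \<open>e\<close> leaves \<open>herm z e\<close>
  fixed and replaces f by F; rotating the line of \<open>e\<close> then keeps only the k-th Taylor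
  term of F.\<close>

lemma integral_mult_herm_power:
  fixes f :: "complex ^ 'n \<Rightarrow> complex"
  assumes f: "continuous_on (shell r) f" "set_integrable lborel (shell r) f" and e: "norm e = 1"
    and F: "F holomorphic_on ball 0 1"
    and mean: "\<And>z. z \<in> shell r \<Longrightarrow> integral {0..1} (\<lambda>x. f (axial 1 (cis (2 * pi * x)) e z)) = F (herm z e)"
  shows "(LINT z:shell r|lborel. f z * cnj (herm z e ^ k)) = (deriv ^^ k) F 0 / fact k * of_real (moment e r k)"
proof -
  let ?c = "\<lambda>x. cis (2 * pi * x)"
  let ?g = "\<lambda>z. f z * cnj (herm z e ^ k)"
  let ?g2 = "\<lambda>z. F (herm z e) * cnj (herm z e ^ k)"
  have c: "continuous_on UNIV ?c" by (intro continuous_intros)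
  have he: "cmod (herm z e) \<le> 1" if "z \<in> shell r" for z
    using herm_less_one[OF that e] by simp
  have g: "continuous_on (shell r) ?g" by (intro continuous_intros f)
  have gi: "set_integrable lborel (shell r) ?g"
    using he by (intro set_integrable_shell_mult_bounded[OF f(2), where B = 1] continuous_intros)
      (simp add: norm_power power_le_one)
  have avg1: "integral {0..1} (\<lambda>x. ?g (axial 1 (?c x) e z)) = ?g2 z" if "z \<in> shell r" for z
    using mean[OF that] by (simp add: herm_axial[OF e])
  have g2: "continuous_on (shell r) ?g2"
    using herm_less_one[OF _ e]
    by (intro continuous_intros continuous_on_compose2[OF holomorphic_on_imp_continuous_on[OF F]]) auto
  \<comment> \<open>F may be unbounded near the unit circle, so integrability is inherited from
    \<open>?g\<close>, of which \<open>?g2\<close> is an average.\<close>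
  have g2i: "set_integrable lborel (shell r) ?g2"
    using shell_average_integrable[OF e, of "\<lambda>_. 1" ?c, OF continuous_on_const c _ _ g gi]
    by (subst set_integrable_cong[OF refl refl avg1, symmetric]) auto
  have avg2: "integral {0..1} (\<lambda>x. ?g2 (axial (?c x) 1 e z)) =
      (deriv ^^ k) F 0 / fact k * of_real (cmod (herm z e) ^ (2 * k))" if "z \<in> shell r" for z
  proof -
    let ?\<zeta> = "herm z e"
    have "integral {0..1} (\<lambda>x. ?g2 (axial (?c x) 1 e z)) =
        integral {0..1} (\<lambda>x. (F (?c x * ?\<zeta>) * cnj (?c x ^ k)) * cnj (?\<zeta> ^ k))"
      by (simp add: herm_axial[OF e] power_mult_distrib mult_ac)
    also have "\<dots> = (deriv ^^ k) F 0 / fact k * (?\<zeta> ^ k * cnj (?\<zeta> ^ k))"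
      using circle_mean_Taylor[OF F herm_less_one[OF that e], of k] by simp
    also have "?\<zeta> ^ k * cnj (?\<zeta> ^ k) = of_real (cmod ?\<zeta> ^ (2 * k))"
      by (simp only: complex_norm_square[symmetric] norm_power power_mult[symmetric] mult.commute)
    finally show ?thesis .
  qed
  have "(LINT z:shell r|lborel. ?g z) = (LINT z:shell r|lborel. ?g2 z)"
    unfolding shell_average_integral[OF e, of "\<lambda>_. 1" ?c, OF continuous_on_const c norm_one norm_cis g gi, symmetric]
    by (intro set_lebesgue_integral_cong allI impI avg1) auto
  also have "\<dots> = (LINT z:shell r|lborel. (deriv ^^ k) F 0 / fact k * of_real (cmod (herm z e) ^ (2 * k)))"
    unfolding shell_average_integral[OF e, of ?c "\<lambda>_. 1", OF c continuous_on_const norm_cis norm_one g2 g2i, symmetric]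
    by (intro set_lebesgue_integral_cong allI impI avg2) auto
  also have "\<dots> = (deriv ^^ k) F 0 / fact k * (LINT z:shell r|lborel. of_real (cmod (herm z e) ^ (2 * k)))"
    by (rule set_integral_mult_right)
  also have "(LINT z:shell r|lborel. complex_of_real (cmod (herm z e) ^ (2 * k))) = of_real (moment e r k)"
    unfolding moment_def by (rule set_integral_complex_of_real)
  finally show ?thesis .
qed

section \<open>Symmetry and uniqueness of Bergman kernels\<close>

text \<open>Each kernel reproduces the other one. With K = K' this is Hermitian symmetry, and
  comparing both cases gives uniqueness.\<close>

lemma bergman_kernel_symmetric:
  assumes "is_bergman_kernel D K" "is_bergman_kernel D K'" "z \<in> D" "w \<in> D"
  shows "K w z = cnj (K' z w)"
proof -
  have "K w z = (LINT x:D|lborel. K x z * cnj (K' x w))"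
    using assms by (simp add: is_bergman_kernel_def)
  also have "\<dots> = cnj (LINT x:D|lborel. K' x w * cnj (K x z))"
    unfolding set_lebesgue_integral_def
    by (subst Bochner_Integration.integral_cnj[symmetric]) (simp add: mult.commute)
  also have "(LINT x:D|lborel. K' x w * cnj (K x z)) = K' z w"
    using assms by (simp add: is_bergman_kernel_def)
  finally show ?thesis .
qed

lemma bergman_kernel_eqI:
  assumes K: "is_bergman_kernel D K"
  shows "bergman_kernel D = K"
  unfolding bergman_kernel_def
proof (rule the_equality)
  show "is_bergman_kernel D K" by (rule K)
next
  fix K' assume K': "is_bergman_kernel D K'"
  show "K' = K"
  proof (intro ext)
    fix z w
    show "K' z w = K z w"
    proof (cases "z \<in> D \<and> w \<in> D")
      case True
      then show ?thesis
        using bergman_kernel_symmetric[OF K' K, of w z] bergman_kernel_symmetric[OF K K, of w z] by simp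
    next
      case False
      then show ?thesis using K K' unfolding is_bergman_kernel_def by metis
    qed
  qed
qed

section \<open>The Bergman kernel of a shell\<close>

text \<open>Polymorphic because the kernel needs complex arguments, while its diagonal, and hence
  the metric, is handled over the reals.\<close>

definition kernel_series :: "complex ^ 'n \<Rightarrow> real \<Rightarrow> 'a \<Rightarrow> 'a::{real_normed_field, banach}" where
  "kernel_series e r x = (\<Sum>k. of_real (inverse (moment e r k)) * x ^ k)"

text \<open>The value 0 off the shell is the normalisation in \<open>is_bergman_kernel\<close>,
  without which the kernel would not be unique as a total function.\<close>

definition shell_kernel ::
    "complex ^ 'n \<Rightarrow> real \<Rightarrow> complex ^ 'n \<Rightarrow> complex ^ 'n \<Rightarrow> complex" where
  "shell_kernel e r z w =
     (if z \<in> shell r \<and> w \<in> shell r then kernel_series e r (herm z w) else 0)"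

lemma summable_kernel_series:
  fixes x :: "'a::{real_normed_field, banach}"
  assumes "norm e = 1" "r < 1" "norm x < 1"
  shows "summable (\<lambda>k. norm (of_real (inverse (moment e r k)) * x ^ k))"
    and "summable (\<lambda>k. of_real (inverse (moment e r k)) * x ^ k)"
proof -
  have "norm (of_real (inverse (moment e r k)) * x ^ k) = inverse (moment e r k) * norm x ^ k" for k
    using moment_pos[OF assms(1,2), of k] by (simp only: norm_mult norm_of_real norm_power) simp
  then show "summable (\<lambda>k. norm (of_real (inverse (moment e r k)) * x ^ k))"
    using summable_inverse_moment[OF assms(1,2) norm_ge_zero assms(3)] by simp
  then show "summable (\<lambda>k. of_real (inverse (moment e r k)) * x ^ k)"
    by (rule summable_norm_cancel)
qed

lemma kernel_series_of_real:
  assumes "norm e = 1" "r < 1" "\<bar>x\<bar> < 1"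
  shows "kernel_series e r (of_real x) = of_real (kernel_series e r x)"
proof -
  have "summable (\<lambda>k. inverse (moment e r k) * x ^ k)"
    using summable_kernel_series(2)[OF assms(1,2), of x] assms(3) by simp
  then show ?thesis
    by (simp add: kernel_series_def suminf_of_real del: of_real_inverse)
qed

lemma herm_less_norm:
  assumes "z \<in> shell r" "w \<in> shell r'"
  shows "cmod (herm z w) \<le> norm w" "cmod (herm z w) < 1"
proof -
  have "norm z * norm w \<le> 1 * norm w" using assms by (intro mult_right_mono) (auto simp: shell_def)
  then show "cmod (herm z w) \<le> norm w" using norm_herm_le[of z w] by simp
  then show "cmod (herm z w) < 1" using assms by (simp add: shell_def)
qed

text \<open>For fixed w, |\<open>herm z w\<close>| <= |w| < 1 on the shell, so the series of norms
  at |w| bounds the kernel uniformly in z; bounded functions on the shell are square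
  integrable.\<close>

lemma shell_kernel_L2h:
  fixes e w :: "complex ^ 'n"
  assumes e: "norm e = 1" and r: "r < 1" and w: "w \<in> shell r"
  shows "(\<lambda>z. shell_kernel e r z w) \<in> L2h (shell r)"
proof -
  let ?b = "\<lambda>k. complex_of_real (inverse (moment e r k))"
  have hol: "holomorphic_vec_on (\<lambda>z. shell_kernel e r z w) (shell r)"
    unfolding holomorphic_vec_on_def
  proof
    fix z :: "complex ^ 'n"
    assume z: "z \<in> shell r"
    define d where "d = (\<Sum>k. diffs ?b k * herm z w ^ k)"
    have "((\<lambda>x. \<Sum>k. ?b k * x ^ k) has_field_derivative d) (at (herm z w))"
      unfolding d_def using summable_kernel_series(2)[OF e r] herm_less_norm[OF z w]
      by (intro termdiffs_strong'[where K = 1]) auto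
    then have "(kernel_series e r has_field_derivative d) (at (herm z w))"
      by (simp add: kernel_series_def[abs_def])
    then have "((\<lambda>z. kernel_series e r (herm z w)) has_derivative (\<lambda>h. d * herm h w)) (at z)"
      using has_derivative_compose[OF bounded_linear_imp_has_derivative[OF bounded_linear_herm]]
      by (auto simp: has_field_derivative_def)
    then have "((\<lambda>z. shell_kernel e r z w) has_derivative (\<lambda>h. d * herm h w)) (at z)"
      by (rule has_derivative_transform_within_open[OF _ open_shell z]) (simp add: shell_kernel_def w)
    then show "\<exists>f'. ((\<lambda>z. shell_kernel e r z w) has_derivative f') (at z) \<and> (\<forall>c v. f' (c *s v) = c * f' v)"
      by (auto simp: herm_smult_left)
  qed
  define B where "B = (\<Sum>k. norm (?b k * of_real (norm w) ^ k))"
  have nw: "norm (complex_of_real (norm w)) < 1" using w by (simp add: shell_def)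
  have bound: "cmod (shell_kernel e r z w) \<le> B" if z: "z \<in> shell r" for z
  proof -
    have "cmod (kernel_series e r (herm z w)) \<le> (\<Sum>k. norm (?b k * herm z w ^ k))"
      unfolding kernel_series_def
      using summable_kernel_series(1)[OF e r herm_less_norm(2)[OF z w]] by (rule summable_norm)
    also have "\<dots> \<le> B"
      unfolding B_def
    proof (rule suminf_le)
      show "norm (?b k * herm z w ^ k) \<le> norm (?b k * of_real (norm w) ^ k)" for k
        unfolding norm_mult norm_power using herm_less_norm(1)[OF z w]
        by (intro mult_left_mono power_mono) auto
    qed (use summable_kernel_series(1)[OF e r nw] summable_kernel_series(1)[OF e r herm_less_norm(2)[OF z w]] in auto)
    finally show ?thesis using z w by (simp add: shell_kernel_def)
  qed
  have "set_integrable lborel (shell r) (\<lambda>z. (cmod (shell_kernel e r z w))\<^sup>2)"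
  proof (rule set_integrable_shell_bounded[where B = "B\<^sup>2"])
    show "continuous_on (shell r) (\<lambda>z. (cmod (shell_kernel e r z w))\<^sup>2)"
      by (intro continuous_intros holomorphic_vec_on_imp_continuous_on[OF hol])
    show "norm ((cmod (shell_kernel e r z w))\<^sup>2) \<le> B\<^sup>2" if "z \<in> shell r" for z
      using bound[OF that] by (simp add: power_mono)
  qed
  with hol show ?thesis by (simp add: L2h_def)
qed

lemma shell_kernel_reproducing:
  fixes f :: "complex ^ 'n \<Rightarrow> complex"
  assumes e: "norm e = 1" and r: "r < 1" and w: "w \<in> shell r"
    and perp: "\<And>e :: complex ^ 'n. norm e = 1 \<Longrightarrow> \<exists>u. norm u = 1 \<and> herm u e = 0"
    and f: "f \<in> L2h (shell r)"
  shows "f w = (LINT z:shell r|lborel. f z * cnj (shell_kernel e r z w))"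
proof -
  have hol: "holomorphic_vec_on f (shell r)" using f by (simp add: L2h_def)
  have int: "set_integrable lborel (shell r) f" using L2h_imp_set_integrable[OF f] .
  have cont: "continuous_on (shell r) f" using holomorphic_vec_on_imp_continuous_on[OF hol] .
  define \<rho> where "\<rho> = norm w"
  have \<rho>: "0 \<le> \<rho>" "\<rho> < 1" "r < \<rho>" using w by (auto simp: \<rho>_def shell_def)
  obtain e' where e': "norm e' = 1" and we: "w = of_real \<rho> *s e'"
  proof (cases "w = 0")
    case True
    \<comment> \<open>The centre of the ball has no direction of its own, so the reference vector is
      taken.\<close>
    then show ?thesis using that[of e] e by (simp add: \<rho>_def)
  next
    case False
    show ?thesis
      by (rule that[of "complex_of_real (1 / \<rho>) *s w"])
        (use False in \<open>simp_all add: \<rho>_def norm_smult_vec norm_divide\<close>)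
  qed
  obtain u where u: "norm u = 1" "herm u e' = 0" using perp[OF e'] by blast
  obtain F where F: "F holomorphic_on ball 0 1"
    "\<And>z. z \<in> shell r \<Longrightarrow> integral {0..1} (\<lambda>x. f (axial 1 (cis (2 * pi * x)) e' z)) = F (herm z e')"
    "\<And>\<zeta>. r < cmod \<zeta> \<Longrightarrow> cmod \<zeta> < 1 \<Longrightarrow> F \<zeta> = f (\<zeta> *s e')"
    using hartogs_average[OF hol r e' u] by blast
  define b where "b = (\<lambda>k. inverse (moment e r k))"
  have bpos: "b k > 0" for k using moment_pos[OF e r] by (simp add: b_def)
  have bsum: "summable (\<lambda>k. b k * \<rho> ^ k)"
    unfolding b_def using summable_inverse_moment[OF e r \<rho>(1,2)] .
  \<comment> \<open>The k-th term of f times the conjugate kernel, extended by zero. It is dominated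
    by \<open>b k * \<rho> ^ k\<close> times |f|, which justifies summing under the
    integral.\<close>
  define t where "t = (\<lambda>k z. indicat_real (shell r) z *\<^sub>R (of_real (b k * \<rho> ^ k) * (f z * cnj (herm z e' ^ k))))"
  have hp: "cmod (herm z e' ^ k) \<le> 1" if "z \<in> shell r" for z k
    using herm_less_one[OF that e'] by (simp add: norm_power power_le_one)
  have "set_integrable lborel (shell r) (\<lambda>z. f z * cnj (herm z e' ^ k))" for k
    using hp by (intro set_integrable_shell_mult_bounded[OF int, where B = 1] continuous_intros)
      (simp del: complex_cnj_power)
  then have ti: "integrable lborel (t k)" for k
    unfolding t_def set_integrable_def[symmetric] by (intro set_integrable_mult_right) auto
  have tn: "norm (t k z) \<le> (b k * \<rho> ^ k) * norm (indicat_real (shell r) z *\<^sub>R f z)" for k z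
  proof (cases "z \<in> shell r")
    case True
    have "(b k * \<rho> ^ k) * (norm (f z) * cmod (herm z e' ^ k)) \<le> (b k * \<rho> ^ k) * (norm (f z) * 1)"
      by (intro mult_left_mono hp[OF True]) (use bpos[of k] \<rho> in auto)
    moreover have "norm (complex_of_real (b k * \<rho> ^ k)) = b k * \<rho> ^ k"
      unfolding norm_of_real using bpos[of k] \<rho> by simp
    then have "norm (t k z) = (b k * \<rho> ^ k) * (norm (f z) * cmod (herm z e' ^ k))"
      using True by (simp only: t_def norm_mult complex_mod_cnj indicator_simps scaleR_one)
    ultimately show ?thesis
      using True by (simp only: indicator_simps scaleR_one mult_1_right)
  qed (simp add: t_def)
  have fi: "integrable lborel (\<lambda>z. norm (indicat_real (shell r) z *\<^sub>R f z))"
    using int unfolding set_integrable_def by (rule integrable_norm)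
  have "(\<lambda>k. integral\<^sup>L lborel (t k)) sums (LINT z|lborel. (\<Sum>k. t k z))"
  proof (rule sums_integral[OF ti])
    show "AE z in lborel. summable (\<lambda>k. norm (t k z))"
    proof (rule AE_I2)
      fix z
      show "summable (\<lambda>k. norm (t k z))"
        by (rule summable_comparison_test'[OF summable_mult2[OF bsum], of 0]) (use tn in simp)
    qed
    show "summable (\<lambda>k. LINT z|lborel. norm (t k z))"
    proof (rule summable_comparison_test'[OF summable_mult2[OF bsum], of 0])
      fix k
      have "(LINT z|lborel. norm (t k z)) \<le> (LINT z|lborel. (b k * \<rho> ^ k) * norm (indicat_real (shell r) z *\<^sub>R f z))"
        by (intro integral_mono integrable_norm[OF ti] integrable_mult_right fi tn)
      also have "\<dots> = (b k * \<rho> ^ k) * (LINT z|lborel. norm (indicat_real (shell r) z *\<^sub>R f z))"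
        by (rule integral_mult_right_zero)
      finally show "norm (LINT z|lborel. norm (t k z)) \<le> (b k * \<rho> ^ k) * (LINT z|lborel. norm (indicat_real (shell r) z *\<^sub>R f z))"
        by simp
    qed
  qed
  moreover have "integral\<^sup>L lborel (t k) = (deriv ^^ k) F 0 / fact k * (of_real \<rho> - 0) ^ k" for k
  proof -
    have "integral\<^sup>L lborel (t k) = of_real (b k * \<rho> ^ k) * (LINT z:shell r|lborel. f z * cnj (herm z e' ^ k))"
      unfolding t_def set_lebesgue_integral_def[symmetric] by (rule set_integral_mult_right)
    also have "\<dots> = of_real (b k * \<rho> ^ k) * ((deriv ^^ k) F 0 / fact k * of_real (moment e r k))"
      using integral_mult_herm_power[OF cont int e' F(1), of k] F(2) moment_unit_eq[OF e' e, of r k] by simp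
    also have "\<dots> = (deriv ^^ k) F 0 / fact k * (of_real \<rho> - 0) ^ k"
      using moment_pos[OF e r, of k] by (simp add: b_def field_simps)
    finally show ?thesis .
  qed
  ultimately have 1: "(\<lambda>k. (deriv ^^ k) F 0 / fact k * (of_real \<rho> - 0) ^ k) sums (LINT z|lborel. (\<Sum>k. t k z))"
    by simp
  have "(\<lambda>k. (deriv ^^ k) F 0 / fact k * (of_real \<rho> - 0) ^ k) sums F (of_real \<rho>)"
    using \<rho> by (intro holomorphic_power_series[OF F(1)]) simp
  with 1 have "(LINT z|lborel. (\<Sum>k. t k z)) = F (of_real \<rho>)" using sums_unique2 by blast
  also have "\<dots> = f w" using F(3)[of "of_real \<rho>"] \<rho> we by simp
  finally have int_eq: "(LINT z|lborel. (\<Sum>k. t k z)) = f w" .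
  have tsum: "(\<Sum>k. t k z) = indicat_real (shell r) z *\<^sub>R (f z * cnj (shell_kernel e r z w))" for z
  proof (cases "z \<in> shell r")
    case True
    have hw: "herm z w = of_real \<rho> * herm z e'" by (simp add: we herm_smult_right)
    have sm: "summable (\<lambda>k. complex_of_real (b k) * herm z w ^ k)"
      unfolding b_def using summable_kernel_series(2)[OF e r herm_less_norm(2)[OF True w]] .
    have "cnj (shell_kernel e r z w) = cnj (\<Sum>k. complex_of_real (b k) * herm z w ^ k)"
      using True w by (simp add: shell_kernel_def kernel_series_def b_def)
    also have "\<dots> = (\<Sum>k. cnj (complex_of_real (b k) * herm z w ^ k))"
      by (rule bounded_linear.suminf[OF bounded_linear_cnj sm])
    finally have "f z * cnj (shell_kernel e r z w) = (\<Sum>k. f z * cnj (complex_of_real (b k) * herm z w ^ k))"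
      using suminf_mult[OF bounded_linear.summable[OF bounded_linear_cnj sm], of "f z"] by simp
    also have "\<dots> = (\<Sum>k. t k z)"
      using True by (simp add: t_def hw power_mult_distrib mult_ac)
    finally show ?thesis using True by simp
  qed (simp add: t_def)
  show ?thesis
    using int_eq unfolding tsum set_lebesgue_integral_def by (rule sym)
qed

lemma bergman_kernel_shell:
  fixes e :: "complex ^ 'n"
  assumes e: "norm e = 1" and r: "r < 1"
    and perp: "\<And>e :: complex ^ 'n. norm e = 1 \<Longrightarrow> \<exists>u. norm u = 1 \<and> herm u e = 0"
  shows "bergman_kernel (shell r) = shell_kernel e r"
proof (rule bergman_kernel_eqI)
  show "is_bergman_kernel (shell r) (shell_kernel e r)"
    unfolding is_bergman_kernel_def
    using shell_kernel_L2h[OF e r] shell_kernel_reproducing[OF e r _ perp] by (auto simp: shell_kernel_def)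
qed

section \<open>The Bergman metric in tangential directions\<close>

lemma real_dir_deriv_eqI:
  assumes "(u has_derivative u') (at p)"
  shows "real_dir_deriv v u p = u' v"
proof -
  have "((\<lambda>t::real. p + t *\<^sub>R v) has_derivative (\<lambda>t. t *\<^sub>R v)) (at 0)"
    by (auto intro!: derivative_eq_intros)
  moreover have "(u has_derivative u') (at (p + 0 *\<^sub>R v))" using assms by simp
  ultimately have "((\<lambda>t::real. u (p + t *\<^sub>R v)) has_derivative (\<lambda>t. u' (t *\<^sub>R v))) (at 0)"
    by (rule has_derivative_compose)
  then have "((\<lambda>t::real. u (p + t *\<^sub>R v)) has_vector_derivative u' v) (at 0)"
    using linear_scale[OF has_derivative_linear[OF assms]] by (simp add: has_vector_derivative_def)
  then show ?thesis
    unfolding real_dir_deriv_def by (rule vector_derivative_at)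
qed

lemma has_derivative_radial:
  fixes z :: "'a::real_inner"
  assumes "(\<phi> has_real_derivative d) (at ((norm z)\<^sup>2))"
  shows "((\<lambda>z. complex_of_real (\<phi> ((norm z)\<^sup>2))) has_derivative (\<lambda>h. of_real (d * (2 * (z \<bullet> h))))) (at z)"
proof -
  have "((\<lambda>z. (norm z)\<^sup>2) has_derivative (\<lambda>h. 2 * (z \<bullet> h))) (at z)"
    unfolding power2_norm_eq_inner
    by (auto intro!: derivative_eq_intros simp: inner_commute)
  from has_derivative_compose[OF this, of \<phi> "\<lambda>h. d * h"]
  have "((\<lambda>z. \<phi> ((norm z)\<^sup>2)) has_derivative (\<lambda>h. d * (2 * (z \<bullet> h)))) (at z)"
    using assms by (simp add: has_field_derivative_def)
  then show ?thesis
    by (rule bounded_linear.has_derivative[OF bounded_linear_of_real])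
qed

text \<open>Chain rule: the derivative of |z|^2 in the k-th conjugate coordinate is
  \<open>z $ k\<close>. The radial form is asked for only on an open set, since the kernel vanishes
  off its domain.\<close>

lemma wirtinger_zbar_radial:
  fixes z :: "complex ^ 'n"
  assumes D: "open D" "z \<in> D"
    and u: "\<And>x. x \<in> D \<Longrightarrow> u x = complex_of_real (\<phi> ((norm x)\<^sup>2))"
    and \<phi>: "(\<phi> has_real_derivative d) (at ((norm z)\<^sup>2))"
  shows "wirtinger_zbar k u z = of_real d * z $ k"
proof -
  have "(u has_derivative (\<lambda>h. of_real (d * (2 * (z \<bullet> h))))) (at z)"
    using has_derivative_radial[OF \<phi>]
    by (rule has_derivative_transform_within_open[OF _ D]) (simp add: u)
  note eq = real_dir_deriv_eqI[OF this]
  have "z \<bullet> axis k 1 = Re (z $ k)" "z \<bullet> axis k \<i> = Im (z $ k)"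
    by (simp_all add: inner_axis inner_complex_def)
  then show ?thesis
    unfolding wirtinger_zbar_def eq by (simp add: complex_eq_iff)
qed

lemma wirtinger_z_radial_times_coordinate:
  fixes p :: "complex ^ 'n"
  assumes D: "open D" "p \<in> D"
    and W: "\<And>x. x \<in> D \<Longrightarrow> W x = complex_of_real (\<phi> ((norm x)\<^sup>2)) * x $ m"
    and \<phi>: "(\<phi> has_real_derivative d) (at ((norm p)\<^sup>2))"
  shows "wirtinger_z k W p = of_real d * cnj (p $ k) * p $ m + (if k = m then of_real (\<phi> ((norm p)\<^sup>2)) else 0)"
proof -
  have "((\<lambda>x. complex_of_real (\<phi> ((norm x)\<^sup>2)) * x $ m) has_derivative
      (\<lambda>h. complex_of_real (\<phi> ((norm p)\<^sup>2)) * h $ m + of_real (d * (2 * (p \<bullet> h))) * p $ m)) (at p)"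
    by (intro has_derivative_mult has_derivative_radial[OF \<phi>] bounded_linear_imp_has_derivative bounded_linear_vec_nth)
  then have "(W has_derivative
      (\<lambda>h. complex_of_real (\<phi> ((norm p)\<^sup>2)) * h $ m + of_real (d * (2 * (p \<bullet> h))) * p $ m)) (at p)"
    by (rule has_derivative_transform_within_open[OF _ D]) (simp add: W)
  note eq = real_dir_deriv_eqI[OF this]
  have inn: "p \<bullet> axis k 1 = Re (p $ k)" "p \<bullet> axis k \<i> = Im (p $ k)"
    by (simp_all add: inner_axis inner_complex_def)
  have cnj: "cnj (p $ k) = of_real (Re (p $ k)) - \<i> * of_real (Im (p $ k))"
    by (simp add: complex_eq_iff)
  then show ?thesis
    unfolding wirtinger_z_def eq inn cnj by (simp add: axis_def field_simps)
qed

text \<open>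
  For \<open>K(z, z) = k(|z|\<^sup>2)\<close> the Hermitian form of \<open>ln K\<close> is
  \<open>(ln k)'' |herm \<xi> p|\<^sup>2 + (ln k)' |\<xi>|\<^sup>2\<close>; tangentially only the second summand survives.
\<close>

lemma bergman_metric_radial:
  fixes p \<xi> :: "complex ^ 'n"
  assumes D: "open D" "p \<in> D"
    and K: "\<And>z. z \<in> D \<Longrightarrow> bergman_kernel D z z = complex_of_real (\<kappa> ((norm z)\<^sup>2))"
    and \<kappa>: "\<And>z. z \<in> D \<Longrightarrow> (\<kappa> has_real_derivative \<kappa>' ((norm z)\<^sup>2)) (at ((norm z)\<^sup>2))"
      "\<And>z. z \<in> D \<Longrightarrow> \<kappa> ((norm z)\<^sup>2) > 0"
    and \<kappa>': "(\<kappa>' has_real_derivative d) (at ((norm p)\<^sup>2))"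
    and perp: "herm \<xi> p = 0"
  shows "bergman_metric D p \<xi> = sqrt (\<kappa>' ((norm p)\<^sup>2) / \<kappa> ((norm p)\<^sup>2) * (norm \<xi>)\<^sup>2)"
proof -
  let ?u = "\<lambda>z. complex_of_real (ln (Re (bergman_kernel D z z)))"
  define \<psi> where "\<psi> = (\<lambda>t. \<kappa>' t / \<kappa> t)"
  have zbar: "wirtinger_zbar m ?u z = of_real (\<psi> ((norm z)\<^sup>2)) * z $ m" if "z \<in> D" for m z
  proof (rule wirtinger_zbar_radial[OF D(1) that])
    show "?u x = complex_of_real (ln (\<kappa> ((norm x)\<^sup>2)))" if "x \<in> D" for x using K[OF that] by simp
    show "((\<lambda>t. ln (\<kappa> t)) has_real_derivative \<psi> ((norm z)\<^sup>2)) (at ((norm z)\<^sup>2))"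
      using \<kappa>[OF that] by (auto intro!: derivative_eq_intros simp: \<psi>_def)
  qed
  \<comment> \<open>Only the existence of this derivative matters: its term in the Hermitian form
    carries the factor \<open>herm \<xi> p\<close>, which is 0.\<close>
  obtain c where c: "(\<psi> has_real_derivative c) (at ((norm p)\<^sup>2))"
    unfolding \<psi>_def using DERIV_divide[OF \<kappa>' \<kappa>(1)[OF D(2)]] \<kappa>(2)[OF D(2)] by force
  let ?\<psi> = "complex_of_real (\<psi> ((norm p)\<^sup>2))"
  have z: "wirtinger_z k (wirtinger_zbar m ?u) p = of_real c * cnj (p $ k) * p $ m + (if k = m then ?\<psi> else 0)" for k m
    by (rule wirtinger_z_radial_times_coordinate[OF D zbar c])
  have "(\<Sum>k\<in>UNIV. \<Sum>m\<in>UNIV. wirtinger_z k (wirtinger_zbar m ?u) p * (\<xi> $ k) * cnj (\<xi> $ m))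
      = (\<Sum>k\<in>UNIV. \<Sum>m\<in>UNIV. of_real c * ((\<xi> $ k * cnj (p $ k)) * (p $ m * cnj (\<xi> $ m)))) +
        (\<Sum>k\<in>UNIV. \<Sum>m\<in>UNIV. if k = m then ?\<psi> * (\<xi> $ k * cnj (\<xi> $ m)) else 0)"
    unfolding z by (simp only: sum.distrib[symmetric]) (intro sum.cong refl, simp add: algebra_simps)
  also have "(\<Sum>k\<in>UNIV. \<Sum>m\<in>UNIV. of_real c * ((\<xi> $ k * cnj (p $ k)) * (p $ m * cnj (\<xi> $ m)))) =
      of_real c * (herm \<xi> p * herm p \<xi>)"
    by (simp only: herm_def sum_product) (simp only: sum_distrib_left)
  also have "(\<Sum>k\<in>UNIV. \<Sum>m\<in>UNIV. if k = m then ?\<psi> * (\<xi> $ k * cnj (\<xi> $ m)) else 0) = ?\<psi> * herm \<xi> \<xi>"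
    by (simp add: herm_def sum_distrib_left)
  finally show ?thesis
    unfolding bergman_metric_def by (simp add: perp herm_self \<psi>_def flip: of_real_mult of_real_power)
qed

section \<open>Comparison of weighted means and scaling of the moments\<close>

text \<open>Let M be the mean of k for the weights \<open>a\<close>. Then M - k and w k - w N change
  sign at the same place, so their product is nonnegative for every k; after weighting by
  \<open>a\<close> and summing, the \<open>w N\<close> part cancels because M is the mean.\<close>

lemma chebyshev_suminf_less:
  fixes a w :: "nat \<Rightarrow> real"
  assumes a: "\<And>k. a k > 0" "summable a" "summable (\<lambda>k. real k * a k)"
    and w: "\<And>i j. i < j \<Longrightarrow> w j < w i" "summable (\<lambda>k. w k * a k)" "summable (\<lambda>k. real k * (w k * a k))"
  shows "(\<Sum>k. real k * (w k * a k)) * (\<Sum>k. a k) < (\<Sum>k. real k * a k) * (\<Sum>k. w k * a k)"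
proof -
  define A where "A = (\<Sum>k. a k)"
  define M where "M = (\<Sum>k. real k * a k) / A"
  have A: "A > 0" unfolding A_def using a by (intro suminf_pos) auto
  have "(\<Sum>k. real k * a k) \<ge> 0" using a by (intro suminf_nonneg) (auto simp: less_imp_le)
  then have M: "M \<ge> 0" using A by (simp add: M_def)
  \<comment> \<open>With the floor of M, k <= M is equivalent to k <= N.\<close>
  define N where "N = nat \<lfloor>M\<rfloor>"
  have N: "real N \<le> M" "M < real N + 1" using M by (auto simp: N_def)
  define g where "g = (\<lambda>k. (M - real k) * (w k - w N) * a k)"
  have g: "g = (\<lambda>k. M * (w k * a k) - real k * (w k * a k) - w N * (M * a k) + w N * (real k * a k))"
    by (simp add: g_def algebra_simps)
  have "g sums (M * (\<Sum>k. w k * a k) - (\<Sum>k. real k * (w k * a k)) - w N * (M * A) + w N * (\<Sum>k. real k * a k))"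
    unfolding g A_def
    by (intro sums_add sums_diff sums_mult summable_sums a w)
  moreover have "M * A = (\<Sum>k. real k * a k)" using A by (simp add: M_def)
  ultimately have gs: "g sums (M * (\<Sum>k. w k * a k) - (\<Sum>k. real k * (w k * a k)))" by simp
  have g0: "0 \<le> g k" for k
  proof (cases "k \<le> N")
    case True
    then have "w N \<le> w k" using w(1)[of k N] by (cases "k = N") auto
    moreover have "real k \<le> M" using True N by linarith
    ultimately show ?thesis using a(1)[of k] by (simp add: g_def)
  next
    case False
    then have "w k \<le> w N" "M \<le> real k" using w(1)[of N k] N by auto
    then show ?thesis using a(1)[of k] by (simp add: g_def mult_nonpos_nonpos)
  qed
  \<comment> \<open>At N the factor w k - w N is zero; Suc N is the first index at which both
    factors are certainly nonzero.\<close>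
  have "0 < g (Suc N)"
    using N w(1)[of N "Suc N"] a(1)[of "Suc N"] by (simp add: g_def mult_neg_neg)
  then have "0 < suminf g"
    using g0 sums_summable[OF gs] by (intro suminf_pos2)
  then have "(\<Sum>k. real k * (w k * a k)) < M * (\<Sum>k. w k * a k)"
    using sums_unique[OF gs] by simp
  then have "(\<Sum>k. real k * (w k * a k)) * A < M * (\<Sum>k. w k * a k) * A"
    using A by (rule mult_strict_right_mono)
  also have "\<dots> = (\<Sum>k. real k * a k) * (\<Sum>k. w k * a k)"
    using A by (simp add: M_def)
  finally show ?thesis by (simp add: A_def)
qed

lemma integral_lborel_scale:
  fixes g :: "'a::euclidean_space \<Rightarrow> real"
  assumes g: "g \<in> borel_measurable borel" and r: "0 < r"
  shows "(LINT z|lborel. g z) = r ^ DIM('a) * (LINT z|lborel. g (r *\<^sub>R z))"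
proof -
  have "(LINT z|lborel. g z) = (LINT z|density (distr lborel borel (\<lambda>z. 0 + r *\<^sub>R z)) (\<lambda>_. \<bar>r\<bar> ^ DIM('a)). g z)"
    using lborel_affine[of r "0 :: 'a"] r by simp
  also have "\<dots> = (LINT z|distr lborel borel (\<lambda>z. 0 + r *\<^sub>R z). \<bar>r\<bar> ^ DIM('a) *\<^sub>R g z)"
    using g by (intro integral_density) auto
  also have "\<dots> = (LINT z|lborel. \<bar>r\<bar> ^ DIM('a) *\<^sub>R g (0 + r *\<^sub>R z))"
    using g by (intro integral_distr) auto
  finally show ?thesis using r by simp
qed

text \<open>The hole is the unit ball scaled by r: the integrand contributes r^(2k) and the volume r
  to the real dimension, which is 2n.\<close>

lemma moment_shell:
  fixes e :: "complex ^ 'n"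
  assumes e: "norm e = 1" and r: "0 < r" "r < 1"
  shows "moment e r k = (1 - r ^ (2 * k + DIM(complex ^ 'n))) * moment e (-1) k"
proof -
  let ?g = "\<lambda>z. cmod (herm z e) ^ (2 * k)"
  have cont: "continuous_on S ?g" for S by (intro continuous_intros)
  have ball: "shell (-1) = (ball 0 1 :: (complex ^ 'n) set)"
    by (auto simp: shell_def) (smt (verit) norm_ge_zero)
  have un: "shell (-1) = shell r \<union> (cball 0 r :: (complex ^ 'n) set)"
    unfolding ball using r by (auto simp: shell_def)
  have int: "set_integrable lborel (cball 0 r) ?g"
    unfolding set_integrable_def by (intro borel_integrable_compact compact_cball cont)
  have "moment e (-1) k = moment e r k + (LINT z:cball 0 r|lborel. ?g z)"
    unfolding moment_def un
    by (intro set_integral_Un set_integrable_moment[OF e] int) (auto simp: shell_def)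
  \<comment> \<open>The removed hole is closed while scaling the unit ball gives an open ball; the
    sphere between them is a null set.\<close>
  also have "(LINT z:cball 0 r|lborel. ?g z) = (LINT z:ball 0 r|lborel. ?g z)"
    unfolding set_lebesgue_integral_def
  proof (rule integral_cong_AE)
    have "sphere 0 r \<in> null_sets (lborel :: (complex ^ 'n) measure)"
      using negligible_sphere[of "0 :: complex ^ 'n" r]
      by (simp add: negligible_iff_null_sets null_sets_completion_iff closed_sphere borel_closed)
    from AE_not_in[OF this]
    show "AE z in lborel. indicat_real (cball 0 r) z *\<^sub>R ?g z = indicat_real (ball 0 r) z *\<^sub>R ?g z"
      by eventually_elim (auto split: split_indicator)
  qed (use borel_measurable_continuous_on_indicator[OF _ cont] in auto)
  also have "\<dots> = r ^ DIM(complex ^ 'n) * (LINT z|lborel. indicat_real (ball 0 r) (r *\<^sub>R z) *\<^sub>R ?g (r *\<^sub>R z))"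
    unfolding set_lebesgue_integral_def
    by (intro integral_lborel_scale r borel_measurable_continuous_on_indicator cont) auto
  also have "(\<lambda>z. indicat_real (ball 0 r) (r *\<^sub>R z) *\<^sub>R ?g (r *\<^sub>R z)) =
      (\<lambda>z. r ^ (2 * k) * (indicat_real (shell (-1)) z *\<^sub>R ?g z))"
    unfolding ball using r
    by (auto simp: herm_scaleR_left norm_mult power_mult_distrib indicator_def)
  also have "(LINT z|lborel. r ^ (2 * k) * (indicat_real (shell (-1)) z *\<^sub>R ?g z)) = r ^ (2 * k) * moment e (-1) k"
    unfolding moment_def set_lebesgue_integral_def by (rule integral_mult_right_zero)
  finally show ?thesis by (simp add: algebra_simps power_add)
qed

lemma
  fixes p \<xi> e :: "complex ^ 'n"
  assumes e: "norm e = 1" and r: "r < 1" and p: "p \<in> shell r" "p \<noteq> 0" and perp: "herm \<xi> p = 0"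
    and ex: "\<forall>e :: complex ^ 'n. norm e = 1 \<longrightarrow> (\<exists>u. norm u = 1 \<and> herm u e = 0)"
  defines "a k \<equiv> inverse (moment e r k) * ((norm p)\<^sup>2) ^ k"
  shows bergman_metric_shell:
      "bergman_metric (shell r) p \<xi> =
        sqrt ((\<Sum>k. real k * a k) / (\<Sum>k. a k) * ((norm \<xi>)\<^sup>2 / (norm p)\<^sup>2))"
    and summable_bergman_metric_shell: "summable a" "summable (\<lambda>k. real k * a k)"
proof -
  define b where "b = (\<lambda>k. inverse (moment e r k))"
  have b: "b k > 0" for k using moment_pos[OF e r] by (simp add: b_def)
  have sm: "summable (\<lambda>k. b k * x ^ k)" if "norm x < 1" for x :: real
    using summable_kernel_series(2)[OF e r that] by (simp add: b_def)
  then have sm': "summable (\<lambda>k. diffs b k * x ^ k)" if "norm x < 1" for x :: real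
    using termdiff_converges[OF that] by blast
  define \<kappa> where "\<kappa> = (\<lambda>x. \<Sum>k. b k * x ^ k)"
  define \<kappa>' where "\<kappa>' = (\<lambda>x. \<Sum>k. diffs b k * x ^ k)"
  let ?t = "(norm p)\<^sup>2"
  have nrm: "norm ((norm z)\<^sup>2) < 1" if "z \<in> shell r" for z :: "complex ^ 'n"
    using that by (simp add: shell_def power_less_one_iff)
  have metric: "bergman_metric (shell r) p \<xi> = sqrt (\<kappa>' ?t / \<kappa> ?t * (norm \<xi>)\<^sup>2)"
  proof (rule bergman_metric_radial[OF open_shell p(1)])
    show "bergman_kernel (shell r) z z = complex_of_real (\<kappa> ((norm z)\<^sup>2))" if "z \<in> shell r" for z :: "complex ^ 'n"
      using kernel_series_of_real[OF e r, of "(norm z)\<^sup>2"] nrm[OF that] that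
      by (simp add: bergman_kernel_shell[OF e r ex[rule_format]] shell_kernel_def herm_self kernel_series_def \<kappa>_def b_def)
    show "(\<kappa> has_real_derivative \<kappa>' ((norm z)\<^sup>2)) (at ((norm z)\<^sup>2))" if "z \<in> shell r" for z :: "complex ^ 'n"
      unfolding \<kappa>_def \<kappa>'_def by (rule termdiffs_strong'[OF sm nrm[OF that]])
    show "(\<kappa>' has_real_derivative (\<Sum>k. diffs (diffs b) k * ?t ^ k)) (at ?t)"
      unfolding \<kappa>'_def by (rule termdiffs_strong'[OF sm' nrm[OF p(1)]])
    show "\<kappa> ((norm z)\<^sup>2) > 0" if "z \<in> shell r" for z :: "complex ^ 'n"
      unfolding \<kappa>_def
      by (rule suminf_pos2[OF sm[OF nrm[OF that]], of 0]) (simp_all add: b less_imp_le)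
  qed (rule perp)
  have t: "?t > 0" using p by simp
  \<comment> \<open>Termwise differentiation lowers the exponent by one. Multiplying by t = |p|^2
    restores it, so t \<kappa>'(t) is the sum of k a_k; this is the origin of the divisor |p|^2 in
    the metric.\<close>
  have "(\<lambda>n. of_nat n * b n * ?t ^ (n - Suc 0) * ?t) sums (\<kappa>' ?t * ?t)"
    unfolding \<kappa>'_def by (intro sums_mult2 diffs_equiv sm' nrm p)
  moreover have "of_nat n * b n * ?t ^ (n - Suc 0) * ?t = real n * a n" for n
    by (cases n) (simp_all add: a_def b_def)
  ultimately have s: "(\<lambda>k. real k * a k) sums (\<kappa>' ?t * ?t)" by simp
  show "summable (\<lambda>k. real k * a k)" using sums_summable[OF s] .
  show "summable a" using sm[OF nrm[OF p(1)]] by (simp add: a_def[abs_def] b_def)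
  have "(\<Sum>k. a k) = \<kappa> ?t" by (simp add: \<kappa>_def a_def b_def)
  then show "bergman_metric (shell r) p \<xi> =
      sqrt ((\<Sum>k. real k * a k) / (\<Sum>k. a k) * ((norm \<xi>)\<^sup>2 / (norm p)\<^sup>2))"
    unfolding metric sums_unique[OF s, symmetric] using t by simp
qed

section \<open>Dimension at least two, and the final comparison\<close>

text \<open>If both \<xi> and \<open>p\<close> lay on the line of \<open>e\<close>, their product
  could not vanish; hence one of them has a nonzero component orthogonal to \<open>e\<close>, which
  is normalised.\<close>

lemma exists_herm_orthogonal:
  fixes p \<xi> e :: "complex ^ 'n"
  assumes "p \<noteq> 0" "\<xi> \<noteq> 0" "herm \<xi> p = 0" and e: "norm e = 1"
  shows "\<exists>u. norm u = 1 \<and> herm u e = 0"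
proof -
  have unit: "\<exists>u. norm u = 1 \<and> herm u e = 0" if "v - herm v e *s e \<noteq> 0" for v
  proof -
    let ?w = "v - herm v e *s e"
    have "norm (complex_of_real (1 / norm ?w) *s ?w) = 1"
      using that by (simp only: norm_smult_vec norm_of_real) simp
    moreover have "herm (complex_of_real (1 / norm ?w) *s ?w) e = 0"
      by (simp only: herm_smult_left herm_complement[OF e] mult_zero_right)
    ultimately show ?thesis by blast
  qed
  have "\<xi> - herm \<xi> e *s e \<noteq> 0 \<or> p - herm p e *s e \<noteq> 0"
  proof (rule ccontr)
    assume "\<not> ?thesis"
    then have eq: "\<xi> = herm \<xi> e *s e" "p = herm p e *s e" by auto
    have "herm \<xi> p = herm \<xi> e * cnj (herm p e)"
      using herm_smult_right[of \<xi> "herm p e" e] eq(2) by (simp add: mult.commute)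
    then have "herm \<xi> e = 0 \<or> herm p e = 0" using assms(3) by simp
    then show False using eq assms(1,2) by auto
  qed
  then show ?thesis using unit by blast
qed

theorem theorem2:
  fixes r :: real and p \<xi> :: "complex ^ 'n"
  assumes "0 < r" and "r < 1"
    and "p \<in> {z. r < norm z \<and> norm z < 1}"
    and "\<xi> \<noteq> 0"
    and "(\<Sum>j\<in>UNIV. \<xi> $ j * cnj (p $ j)) = 0"
  shows "bergman_metric {z. r < norm z \<and> norm z < 1} p \<xi>
       < bergman_metric {z. norm z < 1} p \<xi>"
proof -
  have perp: "herm \<xi> p = 0" using assms(5) by (simp add: herm_def)
  have p0: "p \<noteq> 0" using assms by auto
  have pr: "p \<in> shell r" using assms by (simp add: shell_def)
  have "norm p > -1" using norm_ge_zero[of p] by linarith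
  then have pb: "p \<in> shell (-1)" using assms by (simp add: shell_def)
  have ball: "{z. norm z < 1} = (shell (-1) :: (complex ^ 'n) set)"
    by (auto simp: shell_def) (smt (verit) norm_ge_zero)
  have ex: "\<forall>e :: complex ^ 'n. norm e = 1 \<longrightarrow> (\<exists>u. norm u = 1 \<and> herm u e = 0)"
    using exists_herm_orthogonal[OF p0 assms(4) perp] by blast
  define e where "e = complex_of_real (1 / norm p) *s p"
  have e: "norm e = 1" using p0 by (simp add: e_def norm_smult_vec norm_divide)
  have neg: "(-1::real) < 1" by simp
  let ?d = "DIM(complex ^ 'n)"
  define a where "a = (\<lambda>k. inverse (moment e (-1) k) * ((norm p)\<^sup>2) ^ k)"
  \<comment> \<open>The ratio of the inverse moments of the shell to those of the ball. It decreases
    strictly because r^(2k + 2n) does.\<close>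
  define w where "w = (\<lambda>k. inverse (1 - r ^ (2 * k + ?d)))"
  have q: "r ^ (2 * k + ?d) < 1" for k
    using assms(1,2) by (simp add: power_less_one_iff)
  have w: "w j < w i" if "i < j" for i j
  proof -
    have "r ^ (2 * j + ?d) < r ^ (2 * i + ?d)"
      using that assms(1,2) by (intro power_strict_decreasing) auto
    then show ?thesis
      unfolding w_def using q[of i] q[of j] by (intro less_imp_inverse_less) auto
  qed
  have a: "inverse (moment e (-1) k) * ((norm p)\<^sup>2) ^ k = a k" for k
    by (simp add: a_def)
  have wa: "inverse (moment e r k) * ((norm p)\<^sup>2) ^ k = w k * a k" for k
    by (simp add: moment_shell[OF e assms(1,2)] w_def a_def)
  have apos: "a k > 0" for k
    using moment_pos[OF e neg] p0 by (simp add: a_def)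
  have wpos: "w k > 0" for k using q[of k] by (simp add: w_def)
  note S = bergman_metric_shell[OF e neg pb p0 perp ex, unfolded a]
    summable_bergman_metric_shell[OF e neg pb p0 perp ex, unfolded a]
  note R = bergman_metric_shell[OF e assms(2) pr p0 perp ex, unfolded wa]
    summable_bergman_metric_shell[OF e assms(2) pr p0 perp ex, unfolded wa]
  have "(\<Sum>k. real k * (w k * a k)) * (\<Sum>k. a k) < (\<Sum>k. real k * a k) * (\<Sum>k. w k * a k)"
    by (rule chebyshev_suminf_less[OF apos S(2,3) w R(2,3)])
  moreover have "0 < (\<Sum>k. a k)" "0 < (\<Sum>k. w k * a k)"
    using apos wpos by (intro suminf_pos S R; simp)+
  ultimately have "(\<Sum>k. real k * (w k * a k)) / (\<Sum>k. w k * a k) < (\<Sum>k. real k * a k) / (\<Sum>k. a k)"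
    by (simp add: divide_simps mult.commute)
  moreover have "0 < (norm \<xi>)\<^sup>2 / (norm p)\<^sup>2" using assms(4) p0 by simp
  ultimately have "bergman_metric (shell r) p \<xi> < bergman_metric (shell (-1)) p \<xi>"
    unfolding S(1) R(1) real_sqrt_less_iff by (rule mult_strict_right_mono)
  then show ?thesis by (simp add: ball shell_def[symmetric])
qed

end
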